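(* Suppose that $\omega(\delta)=k(\delta)v=O(\delta^{1/2})$ is a subwavelength resonant frequency of the scattering problem $(\mathrm{SP}_\delta)$ in the case $\delta\to0$, analytic in $\delta^{1/2}$, and that $u(x)$ is the corresponding non-trivial solution with $u(x)=e^{-i\frac{\omega}{v}x}$ for $x<x_1^-$. Then $$u(x)=\begin{cases}a_j+O(\delta^{1/2}),&x\in(x_j^-,x_j^+),\ j=1,2,\dots,N,\\ a_j+b_j(x-x_j^+)+O(\delta^{1/2}),&x\in(x_j^+,x_{j+1}^-),\ j=0,1,2,\dots,N,\end{cases}$$ $$u'(x)=\begin{cases}O(\delta),&x\in(x_j^-,x_j^+),\ j=1,2,\dots,N,\\ b_j+O(\delta^{1/2}),&x\in(x_j^+,x_{j+1}^-),\ j=0,1,2,\dots,N,\end{cases}$$ where $\boldsymbol a=(a_1,a_2,\dots,a_N)^\top$ is the corresponding eigenvector of the generalized capacitance matrix $\mathcal C$ and $b_j=\frac{a_{j+1}-a_j}{s_j}$, $j=1,2,\dots,N-1$. Here $x_0^+:=-M$ and $x_{N+1}^-:=M$ for a large enough $M$.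
   Context: Setting. There are $N$ resonators $(x_j^-,x_j^+)\subset\mathbb{R}$, $1\le j\le N$, with $x_j^-<x_j^+<x_{j+1}^-$; $D=\bigcup_{j=1}^N(x_j^-,x_j^+)$, $\ell_j=x_j^+-x_j^-$, $s_j=x_{j+1}^--x_j^+$. $v$ and $v_b$ are the wave speeds outside and inside $D$, $r=v/v_b$ is a fixed positive constant, and $\delta\in\mathbb{C}$ is the density ratio. For $\omega\in\mathbb{C}$ put $k=\omega/v$ and $k_b=\omega/v_b=rk$. $w|_\pm(x)=\lim_{s\to0^+}w(x\pm s)$. The scattering problem $(\mathrm{SP}_\delta)$ is: $u''+k^2u=0$ on $\mathbb{R}\setminus D$; $u''+k_b^2u=0$ on $D$; for all $1\le j\le N$: $u|_+(x_j^\pm)=u|_-(x_j^\pm)$, $u'|_+(x_j^-)=\delta\,u'|_-(x_j^-)$, $u'|_-(x_j^+)=\delta\,u'|_+(x_j^+)$; and $\left(\frac{d}{d|x|}-ik\right)u=0$ for $x\in(-\infty,x_1^-)\cup(x_N^+,+\infty)$. $\omega$ is a resonant frequency if this problem has a non-trivial solution $u$. A resonant frequency is subwavelength (as $\delta\to0$) if $\omega(\delta)$ depends continuously on $\delta\in\mathbb{C}$ for sufficiently small $\delta$ and $\omega(\delta)\to0$ as $\delta\to0$. Put $(t_1,\dots,t_{2N-1})=(r\ell_1,s_1,r\ell_2,s_2,\dots,s_{N-1},r\ell_N)$ and $\theta_j=\frac1{t_jt_{j+1}}$. The generalized capacitance matrix is the $N\times N$ tridiagonal matrix $$\mathcal C=\begin{pmatrix}\theta_1&-\theta_1\\-\theta_2&\theta_2+\theta_3&-\theta_3\\&-\theta_4&\theta_4+\theta_5&-\theta_5\\&&\ddots&\ddots&\ddots\\&&&-\theta_{2N-4}&\theta_{2N-4}+\theta_{2N-3}&-\theta_{2N-3}\\&&&&-\theta_{2N-2}&\theta_{2N-2}\end{pmatrix},$$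 with eigenvalues $0=\lambda_1<\lambda_2<\dots<\lambda_N$. The non-trivial subwavelength resonances as $\delta\to0$ are $\omega_1(\delta)=O(\delta)$, which corresponds to $\lambda_1=0$, and $\omega_i^\pm(\delta)=\pm v\sqrt{\lambda_i\delta/r}+O(\delta)$, which correspond to $\lambda_i$, $2\le i\le N$; "the corresponding eigenvector" refers to this correspondence. The constants $a_0,b_0,b_N$ on the two outer intervals are not further specified. *)

theory Defs
  imports "HOL-Analysis.Analysis" "HOL-Library.Landau_Symbols" "Jordan_Normal_Form.Char_Poly"
begin

(* Resonator j (1 <= j <= N) is the interval {xm j <..< xp j}, that is xm j, xp j stand for
   x_j^-, x_j^+.  Values of xm and xp at other indices are irrelevant in this file. *)

definition resonator_chain :: "nat \<Rightarrow> (nat \<Rightarrow> real) \<Rightarrow> (nat \<Rightarrow> real) \<Rightarrow> bool" where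
  "resonator_chain N xm xp \<longleftrightarrow>
     1 \<le> N \<and> (\<forall>j\<in>{1..N}. xm j < xp j) \<and> (\<forall>j\<in>{1..<N}. xp j < xm (Suc j))"

definition len :: "(nat \<Rightarrow> real) \<Rightarrow> (nat \<Rightarrow> real) \<Rightarrow> nat \<Rightarrow> real" where
  "len xm xp j = xp j - xm j"

definition spacing :: "(nat \<Rightarrow> real) \<Rightarrow> (nat \<Rightarrow> real) \<Rightarrow> nat \<Rightarrow> real" where
  "spacing xm xp j = xm (Suc j) - xp j"

definition resonator_region :: "nat \<Rightarrow> (nat \<Rightarrow> real) \<Rightarrow> (nat \<Rightarrow> real) \<Rightarrow> real set" where
  "resonator_region N xm xp = (\<Union>j\<in>{1..N}. {xm j<..<xp j})"

definition solves_helmholtz_on :: "real set \<Rightarrow> complex \<Rightarrow> (real \<Rightarrow> complex) \<Rightarrow> bool" where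
  "solves_helmholtz_on S \<kappa> u \<longleftrightarrow>
     (\<forall>x\<in>S. u differentiable (at x) \<and>
        ((\<lambda>y. vector_derivative u (at y)) has_vector_derivative (- (\<kappa>\<^sup>2 * u x))) (at x))"

(* w|_+(x) = c * w|_-(x), resp. w|_-(x) = c * w|_+(x), including existence of both limits. *)

definition jump_right_left :: "(real \<Rightarrow> complex) \<Rightarrow> complex \<Rightarrow> real \<Rightarrow> bool" where
  "jump_right_left w c x \<longleftrightarrow>
     (\<exists>L. (w \<longlongrightarrow> L) (at_left x) \<and> (w \<longlongrightarrow> c * L) (at_right x))"

definition jump_left_right :: "(real \<Rightarrow> complex) \<Rightarrow> complex \<Rightarrow> real \<Rightarrow> bool" where
  "jump_left_right w c x \<longleftrightarrow>
     (\<exists>L. (w \<longlongrightarrow> L) (at_right x) \<and> (w \<longlongrightarrow> c * L) (at_left x))"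

(* The scattering problem.  The exterior equation is imposed on the interior of the closed set
   R - D; at the resonator edges u is in general not differentiable.  The condition
   u|_+ = u|_- is stated as isCont, which also fixes the value of u at the edge as the common
   limit: otherwise a function vanishing except at an edge would be a non-trivial solution for
   every frequency.  d/d|x| is the outward derivative: -d/dx on the left half-line and d/dx
   on the right one, wherever the origin lies. *)

definition scattering_solution ::
  "nat \<Rightarrow> (nat \<Rightarrow> real) \<Rightarrow> (nat \<Rightarrow> real) \<Rightarrow> real \<Rightarrow> real \<Rightarrow> complex \<Rightarrow> complex \<Rightarrow> (real \<Rightarrow> complex) \<Rightarrow> bool"
where
  "scattering_solution N xm xp v vb \<delta> \<omega> u \<longleftrightarrow>
     (let k = \<omega> / of_real v; kb = \<omega> / of_real vb; u' = (\<lambda>x. vector_derivative u (at x));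
          D = resonator_region N xm xp in
        solves_helmholtz_on (interior (- D)) k u \<and>
        solves_helmholtz_on D kb u \<and>
        (\<forall>j\<in>{1..N}. isCont u (xm j) \<and> isCont u (xp j) \<and>
           jump_right_left u' \<delta> (xm j) \<and> jump_left_right u' \<delta> (xp j)) \<and>
        (\<forall>x<xm 1. - u' x - \<i> * k * u x = 0) \<and>
        (\<forall>x>xp N. u' x - \<i> * k * u x = 0))"
  
definition nontrivial_scattering_solution ::
  "nat \<Rightarrow> (nat \<Rightarrow> real) \<Rightarrow> (nat \<Rightarrow> real) \<Rightarrow> real \<Rightarrow> real \<Rightarrow> complex \<Rightarrow> complex \<Rightarrow> (real \<Rightarrow> complex) \<Rightarrow> bool"
where
  "nontrivial_scattering_solution N xm xp v vb \<delta> \<omega> u \<longleftrightarrow>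
     scattering_solution N xm xp v vb \<delta> \<omega> u \<and> (\<exists>x. u x \<noteq> 0)"

definition resonant_frequency ::
  "nat \<Rightarrow> (nat \<Rightarrow> real) \<Rightarrow> (nat \<Rightarrow> real) \<Rightarrow> real \<Rightarrow> real \<Rightarrow> complex \<Rightarrow> complex \<Rightarrow> bool"
where
  "resonant_frequency N xm xp v vb \<delta> \<omega> \<longleftrightarrow>
     (\<exists>u. nontrivial_scattering_solution N xm xp v vb \<delta> \<omega> u)"

(* \<Delta> is the set of density ratios over which \<omega> is followed as \<delta> tends to 0.  The resonances
   behave like a multiple of a square root of \<delta>, which has no continuous branch on a full
   neighbourhood of 0; \<Delta> may be, for example, a slit disc, a sector or the positive reals. *)

definition subwavelength_resonance ::
  "nat \<Rightarrow> (nat \<Rightarrow> real) \<Rightarrow> (nat \<Rightarrow> real) \<Rightarrow> real \<Rightarrow> real \<Rightarrow> complex set \<Rightarrow> (complex \<Rightarrow> complex) \<Rightarrow> bool"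
where
  "subwavelength_resonance N xm xp v vb \<Delta> \<omega> \<longleftrightarrow>
     (\<exists>\<rho>>0. continuous_on (\<Delta> \<inter> ball 0 \<rho>) \<omega> \<and>
        (\<forall>\<delta>\<in>\<Delta> \<inter> ball 0 \<rho>. resonant_frequency N xm xp v vb \<delta> (\<omega> \<delta>))) \<and>
     (\<omega> \<longlongrightarrow> 0) (at 0 within \<Delta>)"

(* \<sigma> is the chosen square root, \<sigma>(\<delta>) = \<delta>^(1/2). *)

definition analytic_in_root :: "complex set \<Rightarrow> (complex \<Rightarrow> complex) \<Rightarrow> (complex \<Rightarrow> complex) \<Rightarrow> bool"
where
  "analytic_in_root \<Delta> \<sigma> \<omega> \<longleftrightarrow>
     (\<exists>W. W analytic_on {0} \<and> (\<forall>\<^sub>F \<delta> in at 0 within \<Delta>. \<omega> \<delta> = W (\<sigma> \<delta>)))"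

(* t_1, ..., t_(2N-1) = r l_1, s_1, r l_2, s_2, ..., s_(N-1), r l_N *)

definition tseq :: "(nat \<Rightarrow> real) \<Rightarrow> (nat \<Rightarrow> real) \<Rightarrow> real \<Rightarrow> nat \<Rightarrow> real" where
  "tseq xm xp r m =
     (if odd m then r * len xm xp (Suc m div 2) else spacing xm xp (m div 2))"

definition theta :: "(nat \<Rightarrow> real) \<Rightarrow> (nat \<Rightarrow> real) \<Rightarrow> real \<Rightarrow> nat \<Rightarrow> real" where
  "theta xm xp r m = 1 / (tseq xm xp r m * tseq xm xp r (Suc m))"

(* Matrix indices of the library start at 0: row i here is the (i+1)-st row of the matrix.
   For N = 1 this is the 1 x 1 zero matrix. *)

definition capacitance_matrix ::
  "nat \<Rightarrow> (nat \<Rightarrow> real) \<Rightarrow> (nat \<Rightarrow> real) \<Rightarrow> real \<Rightarrow> real mat" where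
  "capacitance_matrix N xm xp r = mat N N (\<lambda>(i, j).
     if i = Suc j then - theta xm xp r (2 * i)
     else if j = i then
       (if i = 0 then 0 else theta xm xp r (2 * i)) +
       (if Suc i = N then 0 else theta xm xp r (2 * i + 1))
     else if j = Suc i then - theta xm xp r (2 * i + 1)
     else 0)"

(* The resonance \<omega> corresponds to the eigenvalue ev of the capacitance matrix:
   \<omega> = + v sqrt(ev \<delta> / r) + O(\<delta>) or \<omega> = - v sqrt(ev \<delta> / r) + O(\<delta>); for ev = 0 this reads
   \<omega> = O(\<delta>). *)

definition corresponds_to_eigenvalue ::
  "real \<Rightarrow> real \<Rightarrow> complex set \<Rightarrow> (complex \<Rightarrow> complex) \<Rightarrow> (complex \<Rightarrow> complex) \<Rightarrow> real \<Rightarrow> bool" where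
  "corresponds_to_eigenvalue v r \<Delta> \<sigma> \<omega> ev \<longleftrightarrow>
     (\<exists>\<epsilon>\<in>{1, -1}. (\<lambda>\<delta>. \<omega> \<delta> - \<epsilon> * of_real (v * sqrt (ev / r)) * \<sigma> \<delta>)
        \<in> O[at 0 within \<Delta>](\<lambda>\<delta>. \<delta>))"

(* f(\<delta>, x) = O(g(\<delta>)) as \<delta> tends to 0 in \<Delta>, uniformly in x \<in> S. *)

definition unif_bigo ::
  "complex set \<Rightarrow> real set \<Rightarrow> (complex \<Rightarrow> real \<Rightarrow> complex) \<Rightarrow> (complex \<Rightarrow> complex) \<Rightarrow> bool" where
  "unif_bigo \<Delta> S f g \<longleftrightarrow>
     (\<lambda>(\<delta>, x). f \<delta> x) \<in> O[(at 0 within \<Delta>) \<times>\<^sub>F principal S](\<lambda>(\<delta>, x). g \<delta>)"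

end

theory Submission
  imports Defs "HOL-Complex_Analysis.Cauchy_Integral_Formula"
begin

text \<open>
  Write \<open>\<sigma>\<close> for the square root of \<open>\<delta>\<close>.  The solution is followed from left to right, one interval
  at a time; an interval together with the boundary values of the derivative is called an arc
  below.  Since \<open>\<omega> = O(\<sigma>)\<close>, the squared wave number is \<open>O(\<delta>)\<close> on every arc, so a solution is
  affine up to \<open>O(\<delta>)\<close>, with a bound proportional to its data at the left end
  (\<open>helmholtz_between_estimates\<close>).  On a gap this is all that is needed (\<open>arc_expansion\<close>).  On a
  resonator the jump condition makes the initial slope \<open>O(\<delta>)\<close>, so \<open>u\<close> is constant to leading
  order and \<open>u'\<close> is \<open>O(\<delta>)\<close>.  The next term cannot be dropped there: at the right edge the
  slope is divided by \<open>\<delta>\<close>, and the increment \<open>- k\<^sub>b\<^sup>2 l\<^sub>j a\<^sub>j\<close> of \<open>u'\<close> across the resonator, of order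
  \<open>\<delta>\<close>, becomes a jump of order one between the slopes in the two adjacent gaps
  (\<open>resonator_expansion\<close>).

  Analyticity gives \<open>\<omega> = c \<sigma> + O(\<delta>)\<close>, so \<open>k\<^sub>b\<^sup>2 / \<delta>\<close> tends to \<open>\<mu> = (c / v\<^sub>b)\<^sup>2\<close> with error \<open>O(\<sigma>)\<close>.  The
  limiting values \<open>a\<^sub>j\<close> and slopes \<open>b\<^sub>j\<close> therefore satisfy
  \<open>a\<^bsub>j+1\<^esub> = a\<^sub>j + b\<^sub>j s\<^sub>j\<close> and \<open>b\<^bsub>j+1\<^esub> = b\<^sub>j - \<mu> l\<^bsub>j+1\<^esub> a\<^bsub>j+1\<^esub>\<close>.
  They start from \<open>a\<^sub>0 = 1\<close>, \<open>b\<^sub>0 = 0\<close>, because \<open>u\<close> is a slow exponential on the left, and the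
  radiation condition on the right, \<open>u' = i k u = O(\<sigma>)\<close>, forces \<open>b\<^sub>N = 0\<close>.

  Eliminating the slopes, this boundary value problem for the recursion says exactly that
  \<open>a\<close> is an eigenvector of the capacitance matrix for the eigenvalue \<open>\<mu> / r\<close>
  (\<open>capacitance_matrix_eigenvector\<close>).  Summation by parts shows \<open>\<mu> \<ge> 0\<close>
  (\<open>limit_parameter_nonneg_real\<close>), hence \<open>c = \<plusminus> v sqrt (ev / r)\<close> with \<open>ev = \<mu> / r\<close>, which is the
  required correspondence between resonance and eigenvalue.
\<close>

section \<open>Solutions of the Helmholtz equation for small wave numbers\<close>

text \<open>
  The derivative of a scattering solution jumps at the edges, so the slopes \<open>p\<close> and \<open>q\<close> at the two
  ends are one-sided limits from inside the interval.
\<close>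

definition helmholtz_between ::
  "complex \<Rightarrow> real \<Rightarrow> complex \<Rightarrow> real \<Rightarrow> complex \<Rightarrow> (real \<Rightarrow> complex) \<Rightarrow> bool" where
  "helmholtz_between \<kappa> \<alpha> p \<beta> q u \<longleftrightarrow>
     continuous_on {\<alpha>..\<beta>} u \<and> solves_helmholtz_on {\<alpha><..<\<beta>} \<kappa> u \<and>
     ((\<lambda>x. vector_derivative u (at x)) \<longlongrightarrow> p) (at_right \<alpha>) \<and>
     ((\<lambda>x. vector_derivative u (at x)) \<longlongrightarrow> q) (at_left \<beta>)"

lemma increment_le_derivative_bound:
  fixes f :: "real \<Rightarrow> 'a::real_normed_vector"
  assumes "\<alpha> \<le> x" "continuous_on {\<alpha>..x} f"
    and "\<And>y. \<alpha> < y \<Longrightarrow> y < x \<Longrightarrow> (f has_vector_derivative f' y) (at y)"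
    and "\<And>y. \<alpha> < y \<Longrightarrow> y < x \<Longrightarrow> norm (f' y) \<le> C"
  shows "norm (f x - f \<alpha>) \<le> C * (x - \<alpha>)"
proof (cases "\<alpha> = x")
  case False
  with assms(1) have "\<alpha> < x" by simp
  then have "norm (f x - f \<alpha>) \<le> C * x - C * \<alpha>"
    using assms
    by (intro differentiable_bound_general[where f' = f' and \<phi> = "\<lambda>y. C * y" and \<phi>' = "\<lambda>_. C"])
       (auto intro!: continuous_intros derivative_eq_intros)
  then show ?thesis by (simp add: algebra_simps)
qed simp

text \<open>
  Replacing the derivative at the two ends by its one-sided limits gives a continuous function
  on the closed interval, to which the mean value inequality applies.
\<close>

lemma helmholtz_between_closed_derivative:
  assumes "\<alpha> < \<beta>" "helmholtz_between \<kappa> \<alpha> p \<beta> q u"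
  obtains w where "continuous_on {\<alpha>..\<beta>} w" "w \<alpha> = p" "w \<beta> = q"
    "\<And>x. \<alpha> < x \<Longrightarrow> x < \<beta> \<Longrightarrow> w x = vector_derivative u (at x)"
    "\<And>x. \<alpha> < x \<Longrightarrow> x < \<beta> \<Longrightarrow> (u has_vector_derivative w x) (at x)"
    "\<And>x. \<alpha> < x \<Longrightarrow> x < \<beta> \<Longrightarrow> (w has_vector_derivative - (\<kappa>\<^sup>2 * u x)) (at x)"
proof
  let ?d = "\<lambda>x. vector_derivative u (at x)"
  define w where "w x = (if x = \<alpha> then p else if x = \<beta> then q else ?d x)" for x
  have solves: "solves_helmholtz_on {\<alpha><..<\<beta>} \<kappa> u"
    and lim: "(?d \<longlongrightarrow> p) (at_right \<alpha>)" "(?d \<longlongrightarrow> q) (at_left \<beta>)"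
    using assms(2) by (auto simp: helmholtz_between_def)
  show wi: "w x = ?d x" if "\<alpha> < x" "x < \<beta>" for x
    using that by (simp add: w_def)
  show "w \<alpha> = p" "w \<beta> = q"
    using assms(1) by (auto simp: w_def)
  show u: "(u has_vector_derivative w x) (at x)" if "\<alpha> < x" "x < \<beta>" for x
    using solves that vector_derivative_works[of u "at x"]
    by (auto simp: solves_helmholtz_on_def wi)
  show w': "(w has_vector_derivative - (\<kappa>\<^sup>2 * u x)) (at x)" if "\<alpha> < x" "x < \<beta>" for x
  proof (rule has_vector_derivative_transform_within_open[where S = "{\<alpha><..<\<beta>}"])
    show "(?d has_vector_derivative - (\<kappa>\<^sup>2 * u x)) (at x)"
      using solves that by (auto simp: solves_helmholtz_on_def)
  qed (use that wi in auto)
  show "continuous_on {\<alpha>..\<beta>} w"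
  proof (rule continuous_on_IccI)
    have "eventually (\<lambda>x. ?d x = w x) (at_right \<alpha>)"
      using eventually_at_right_less[of \<alpha>] eventually_at_right_real[OF assms(1)]
      by eventually_elim (simp add: wi)
    then show "(w \<longlongrightarrow> w \<alpha>) (at_right \<alpha>)"
      using lim(1) \<open>w \<alpha> = p\<close> by (simp add: filterlim_cong)
    have "eventually (\<lambda>x. ?d x = w x) (at_left \<beta>)"
      using eventually_at_left_real[OF assms(1)]
      by eventually_elim (simp add: wi)
    then show "(w \<longlongrightarrow> w \<beta>) (at_left \<beta>)"
      using lim(2) \<open>w \<beta> = q\<close> by (simp add: filterlim_cong)
    show "w \<midarrow>x\<rightarrow> w x" if "\<alpha> < x" "x < \<beta>" for x
      using has_vector_derivative_continuous[OF w'[OF that]] by (simp add: continuous_at isContD)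
  qed fact
qed

text \<open>
  Integrating \<open>u'' = - \<kappa>\<^sup>2 u\<close> twice bounds the deviation of \<open>u\<close> from its tangent at the left end
  by \<open>\<bar>\<kappa>\<bar>\<^sup>2 l\<^sup>2 sup \<bar>u\<bar>\<close>.  When \<open>\<bar>\<kappa>\<bar>\<^sup>2 l\<^sup>2 \<le> 1/2\<close> this also bounds the supremum itself by \<open>E\<close>,
  that is, by the data at the left end.  The last estimate is one order finer:
  it isolates the increment \<open>- \<kappa>\<^sup>2 l u(\<alpha>)\<close> of the slope.
\<close>

lemma helmholtz_between_estimates:
  fixes \<alpha> \<beta> :: real
  defines "l \<equiv> \<beta> - \<alpha>"
  assumes "\<alpha> < \<beta>" and between: "helmholtz_between \<kappa> \<alpha> p \<beta> q u"
    and small: "(norm \<kappa>)\<^sup>2 * l\<^sup>2 \<le> 1 / 2"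
  defines "E \<equiv> 2 * (norm (u \<alpha>) + norm p * l)"
  shows "\<And>x. \<alpha> \<le> x \<Longrightarrow> x \<le> \<beta> \<Longrightarrow> norm (u x - u \<alpha> - p * of_real (x - \<alpha>)) \<le> (norm \<kappa>)\<^sup>2 * l\<^sup>2 * E"
    and "\<And>x. \<alpha> < x \<Longrightarrow> x < \<beta> \<Longrightarrow> norm (vector_derivative u (at x) - p) \<le> (norm \<kappa>)\<^sup>2 * l * E"
    and "norm (q - p) \<le> (norm \<kappa>)\<^sup>2 * l * E"
    and "norm (q - p + \<kappa>\<^sup>2 * of_real l * u \<alpha>) \<le> (norm \<kappa>)\<^sup>2 * l * (norm p * l + (norm \<kappa>)\<^sup>2 * l\<^sup>2 * E)"
proof -
  let ?K = "(norm \<kappa>)\<^sup>2"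
  have l: "l > 0" using assms by simp
  have cont: "continuous_on {\<alpha>..\<beta>} u"
    using between by (simp add: helmholtz_between_def)
  obtain w where w: "continuous_on {\<alpha>..\<beta>} w" "w \<alpha> = p" "w \<beta> = q"
    and wd: "\<And>x. \<alpha> < x \<Longrightarrow> x < \<beta> \<Longrightarrow> w x = vector_derivative u (at x)"
    and u': "\<And>x. \<alpha> < x \<Longrightarrow> x < \<beta> \<Longrightarrow> (u has_vector_derivative w x) (at x)"
    and w': "\<And>x. \<alpha> < x \<Longrightarrow> x < \<beta> \<Longrightarrow> (w has_vector_derivative - (\<kappa>\<^sup>2 * u x)) (at x)"
    by (rule helmholtz_between_closed_derivative[OF \<open>\<alpha> < \<beta>\<close> between]) (rule that)
  have "\<exists>m\<in>{\<alpha>..\<beta>}. \<forall>x\<in>{\<alpha>..\<beta>}. norm (u x) \<le> norm (u m)"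
    using \<open>\<alpha> < \<beta>\<close> by (intro continuous_attains_sup continuous_on_norm cont) auto
  then obtain m where m: "m \<in> {\<alpha>..\<beta>}" "\<And>x. x \<in> {\<alpha>..\<beta>} \<Longrightarrow> norm (u x) \<le> norm (u m)"
    by blast
  define S where "S = norm (u m)"
  have S0: "S \<ge> 0" by (simp add: S_def)
  have wp: "norm (w x - p) \<le> ?K * l * S" if x: "\<alpha> \<le> x" "x \<le> \<beta>" for x
  proof -
    have "norm (w x - w \<alpha>) \<le> (?K * S) * (x - \<alpha>)"
    proof (rule increment_le_derivative_bound)
      show "continuous_on {\<alpha>..x} w"
        using w(1) by (rule continuous_on_subset) (use x in auto)
      show "norm (- (\<kappa>\<^sup>2 * u y)) \<le> ?K * S" if "\<alpha> < y" "y < x" for y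
        using m(2)[of y] that x by (auto simp: norm_mult norm_power S_def intro!: mult_left_mono)
    qed (use x w' in auto)
    also have "\<dots> \<le> (?K * S) * l"
      using x S0 by (intro mult_left_mono) (auto simp: l_def)
    finally show ?thesis using w(2) by (simp add: mult_ac)
  qed
  have up: "norm (u x - u \<alpha> - p * of_real (x - \<alpha>)) \<le> ?K * l\<^sup>2 * S" if x: "\<alpha> \<le> x" "x \<le> \<beta>" for x
  proof -
    have "norm ((u x - p * of_real x) - (u \<alpha> - p * of_real \<alpha>)) \<le> (?K * l * S) * (x - \<alpha>)"
    proof (rule increment_le_derivative_bound)
      show "continuous_on {\<alpha>..x} (\<lambda>x. u x - p * of_real x)"
        by (intro continuous_intros continuous_on_subset[OF cont]) (use x in auto)
      show "((\<lambda>x. u x - p * of_real x) has_vector_derivative w y - p) (at y)" if "\<alpha> < y" "y < x" for y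
        using u'[of y] that x by (auto intro!: derivative_eq_intros)
    qed (use x wp in auto)
    also have "\<dots> \<le> (?K * l * S) * l"
      using x S0 l by (intro mult_left_mono) (auto simp: l_def)
    finally show ?thesis by (simp add: algebra_simps power2_eq_square)
  qed
  \<comment> \<open>Half of the supremum is absorbed on the left.\<close>
  have "S \<le> E"
  proof -
    have "norm (p * of_real (m - \<alpha>)) \<le> norm p * l"
      using m(1) by (auto simp: norm_mult l_def simp del: of_real_diff intro!: mult_left_mono)
    moreover have "S \<le> norm (u m - u \<alpha> - p * of_real (m - \<alpha>)) + norm (u \<alpha>) + norm (p * of_real (m - \<alpha>))"
      unfolding S_def by norm
    moreover have "?K * l\<^sup>2 * S \<le> 1 / 2 * S"
      using small S0 by (intro mult_right_mono) auto
    moreover have "norm (u m - u \<alpha> - p * of_real (m - \<alpha>)) \<le> ?K * l\<^sup>2 * S"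
      using up m(1) by simp
    ultimately have "S \<le> 1 / 2 * S + norm (u \<alpha>) + norm p * l"
      by (meson add_mono order_trans order_refl)
    then show ?thesis by (simp add: E_def field_simps)
  qed
  show A: "norm (u x - u \<alpha> - p * of_real (x - \<alpha>)) \<le> ?K * l\<^sup>2 * E" if "\<alpha> \<le> x" "x \<le> \<beta>" for x
    using up[OF that] mult_left_mono[OF \<open>S \<le> E\<close>, of "?K * l\<^sup>2"] by simp
  have B: "norm (w x - p) \<le> ?K * l * E" if "\<alpha> \<le> x" "x \<le> \<beta>" for x
    using wp[OF that] mult_left_mono[OF \<open>S \<le> E\<close>, of "?K * l"] l by simp
  show "norm (vector_derivative u (at x) - p) \<le> ?K * l * E" if "\<alpha> < x" "x < \<beta>" for x
    using B[of x] that wd by simp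
  show "norm (q - p) \<le> ?K * l * E"
    using B[of \<beta>] w(3) \<open>\<alpha> < \<beta>\<close> by simp
  \<comment> \<open>For the finer estimate \<open>u(\<alpha>)\<close> is subtracted from \<open>u\<close> in the equation, which leaves a source
      bounded by the variation of \<open>u\<close>.\<close>
  let ?F = "norm p * l + ?K * l\<^sup>2 * E"
  have "norm ((w \<beta> + \<kappa>\<^sup>2 * u \<alpha> * of_real \<beta>) - (w \<alpha> + \<kappa>\<^sup>2 * u \<alpha> * of_real \<alpha>)) \<le> (?K * ?F) * (\<beta> - \<alpha>)"
  proof (rule increment_le_derivative_bound)
    show "continuous_on {\<alpha>..\<beta>} (\<lambda>x. w x + \<kappa>\<^sup>2 * u \<alpha> * of_real x)"
      by (intro continuous_intros w(1))
    show "((\<lambda>x. w x + \<kappa>\<^sup>2 * u \<alpha> * of_real x) has_vector_derivative - (\<kappa>\<^sup>2 * (u y - u \<alpha>))) (at y)"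
      if "\<alpha> < y" "y < \<beta>" for y
      using w'[OF that] by (auto intro!: derivative_eq_intros simp: algebra_simps)
    fix y assume y: "\<alpha> < y" "y < \<beta>"
    have "norm (p * of_real (y - \<alpha>)) \<le> norm p * l"
      using y by (auto simp: norm_mult l_def simp del: of_real_diff intro!: mult_left_mono)
    moreover have "norm (u y - u \<alpha>) \<le> norm (u y - u \<alpha> - p * of_real (y - \<alpha>)) + norm (p * of_real (y - \<alpha>))"
      by norm
    ultimately have "norm (u y - u \<alpha>) \<le> ?F"
      using A[of y] y by simp
    then show "norm (- (\<kappa>\<^sup>2 * (u y - u \<alpha>))) \<le> ?K * ?F"
      by (auto simp: norm_mult norm_power intro!: mult_left_mono)
  qed (use \<open>\<alpha> < \<beta>\<close> in auto)
  then show "norm (q - p + \<kappa>\<^sup>2 * of_real l * u \<alpha>) \<le> ?K * l * ?F"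
    using w by (simp add: l_def algebra_simps)
qed

section \<open>The arcs of a scattering solution\<close>

lemma resonator_chain_xp_mono:
  assumes "resonator_chain N xm xp" "1 \<le> i" "i \<le> j" "j \<le> N"
  shows "xp i \<le> xp j"
  using assms(3,4)
proof (induction j rule: dec_induct)
  case (step n)
  then have "xp n < xm (Suc n)" "xm (Suc n) < xp (Suc n)"
    using assms(1,2) by (auto simp: resonator_chain_def)
  then show ?case using step by simp
qed simp

text \<open>
  The premises on \<open>y\<close> are conditional so that the two unbounded outer intervals are covered by
  \<open>j = 0\<close> and \<open>j = N\<close>.
\<close>

lemma gap_disjoint_resonator_region:
  assumes chain: "resonator_chain N xm xp" and "j \<le> N"
    and lower: "1 \<le> j \<Longrightarrow> xp j \<le> y" and upper: "j < N \<Longrightarrow> y \<le> xm (Suc j)"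
  shows "y \<notin> resonator_region N xm xp"
proof
  assume "y \<in> resonator_region N xm xp"
  then obtain i where i: "1 \<le> i" "i \<le> N" "xm i < y" "y < xp i"
    by (auto simp: resonator_region_def)
  show False
  proof (cases "i \<le> j")
    case True
    then show ?thesis
      using resonator_chain_xp_mono[OF chain i(1) True \<open>j \<le> N\<close>] lower i by simp
  next
    case False
    have "xm (Suc j) \<le> xm i"
    proof (cases "i = Suc j")
      case neq: False
      then obtain n where n: "i = Suc n" "Suc j \<le> n"
        using False by (cases i) auto
      then have "xp n < xm (Suc n)" "xm (Suc j) < xp (Suc j)" "xp (Suc j) \<le> xp n"
        using chain i resonator_chain_xp_mono[OF chain, of "Suc j" n]
        by (auto simp: resonator_chain_def)
      then show ?thesis using n by simp
    qed simp
    then show ?thesis using upper False i by simp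
  qed
qed

lemma solves_helmholtz_on_imp_isCont:
  assumes "solves_helmholtz_on S \<kappa> u" "x \<in> S"
  shows "isCont u x"
  using assms differentiable_imp_continuous_within by (auto simp: solves_helmholtz_on_def)

lemma helmholtz_betweenI:
  assumes "\<alpha> < \<beta>" and solves: "solves_helmholtz_on S \<kappa> u" "{\<alpha><..<\<beta>} \<subseteq> S"
    and "isCont u \<alpha>" "isCont u \<beta>"
    and "((\<lambda>x. vector_derivative u (at x)) \<longlongrightarrow> p) (at_right \<alpha>)"
    and "((\<lambda>x. vector_derivative u (at x)) \<longlongrightarrow> q) (at_left \<beta>)"
  shows "helmholtz_between \<kappa> \<alpha> p \<beta> q u"
proof -
  have "isCont u x" if "x \<in> {\<alpha>..\<beta>}" for x
  proof (cases "x = \<alpha> \<or> x = \<beta>")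
    case False
    then show ?thesis
      using that solves by (intro solves_helmholtz_on_imp_isCont[OF solves(1)]) auto
  qed (use assms in auto)
  then have "continuous_on {\<alpha>..\<beta>} u"
    by (intro continuous_at_imp_continuous_on) auto
  then show ?thesis
    using assms by (auto simp: helmholtz_between_def solves_helmholtz_on_def)
qed

text \<open>
  All transmission and radiation conditions are encoded in two families of slopes taken on
  the exterior side: \<open>Q j\<close> just to the left of resonator \<open>j\<close> and \<open>B j\<close> just to the right of it.
  The interior slopes are then \<open>\<delta> Q j\<close> and \<open>\<delta> B j\<close>.  The bounded outer intervals, from \<open>xp 0\<close> to the
  first resonator and from the last one to \<open>xm (Suc N)\<close>, become arcs like the gaps.
\<close>

lemma scattering_solution_arcs:
  assumes chain: "resonator_chain N xm xp"
    and sol: "scattering_solution N xm xp v vb \<delta> \<omega> u"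
    and outer: "xp 0 < xm 1" "xp N < xm (Suc N)"
  obtains Q B :: "nat \<Rightarrow> complex" where
    "\<And>j. j \<in> {1..N} \<Longrightarrow> helmholtz_between (\<omega> / of_real vb) (xm j) (\<delta> * Q j) (xp j) (\<delta> * B j) u"
    "\<And>j. j \<le> N \<Longrightarrow> helmholtz_between (\<omega> / of_real v) (xp j) (B j) (xm (Suc j)) (Q (Suc j)) u"
    "B 0 = - \<i> * (\<omega> / of_real v) * u (xp 0)"
    "B N = \<i> * (\<omega> / of_real v) * u (xp N)"
proof -
  define k where "k = \<omega> / of_real v"
  let ?D = "resonator_region N xm xp"
  let ?d = "\<lambda>x. vector_derivative u (at x)"
  have solves: "solves_helmholtz_on (interior (- ?D)) k u" "solves_helmholtz_on ?D (\<omega> / of_real vb) u"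
    and edges: "\<And>j. j \<in> {1..N} \<Longrightarrow> isCont u (xm j) \<and> isCont u (xp j) \<and>
          jump_right_left ?d \<delta> (xm j) \<and> jump_left_right ?d \<delta> (xp j)"
    and left: "\<And>x. x < xm 1 \<Longrightarrow> ?d x = - \<i> * k * u x"
    and right: "\<And>x. x > xp N \<Longrightarrow> ?d x = \<i> * k * u x"
    using sol by (auto simp: scattering_solution_def Let_def k_def algebra_simps neg_eq_iff_add_eq_0
                       simp flip: eq_neg_iff_add_eq_0)
  have N: "1 \<le> N" using chain by (simp add: resonator_chain_def)
  have "\<forall>j\<in>{1..N}. \<exists>L. (?d \<longlongrightarrow> L) (at_left (xm j)) \<and> (?d \<longlongrightarrow> \<delta> * L) (at_right (xm j))"
    using edges by (auto simp: jump_right_left_def)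
  then obtain Q0 where Q0: "\<And>j. j \<in> {1..N} \<Longrightarrow>
      (?d \<longlongrightarrow> Q0 j) (at_left (xm j)) \<and> (?d \<longlongrightarrow> \<delta> * Q0 j) (at_right (xm j))"
    by metis
  have "\<forall>j\<in>{1..N}. \<exists>L. (?d \<longlongrightarrow> L) (at_right (xp j)) \<and> (?d \<longlongrightarrow> \<delta> * L) (at_left (xp j))"
    using edges by (auto simp: jump_left_right_def)
  then obtain B0 where B0: "\<And>j. j \<in> {1..N} \<Longrightarrow>
      (?d \<longlongrightarrow> B0 j) (at_right (xp j)) \<and> (?d \<longlongrightarrow> \<delta> * B0 j) (at_left (xp j))"
    by metis
  define B where "B j = (if j = 0 then - \<i> * k * u (xp 0) else B0 j)" for j
  define Q where "Q j = (if j = Suc N then \<i> * k * u (xm (Suc N)) else Q0 j)" for j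
  have inner_sub: "{xm j<..<xp j} \<subseteq> ?D" if "j \<in> {1..N}" for j
    using that by (auto simp: resonator_region_def)
  have gap_sub: "{xp j<..<xm (Suc j)} \<subseteq> interior (- ?D)" if "j \<le> N" for j
    using gap_disjoint_resonator_region[OF chain that]
    by (intro interior_maximal) (auto simp: less_imp_le)
  have left_sub: "{..<xm 1} \<subseteq> interior (- ?D)"
    using gap_disjoint_resonator_region[OF chain, of 0]
    by (intro interior_maximal) (auto simp: less_imp_le)
  have right_sub: "{xp N<..} \<subseteq> interior (- ?D)"
    using gap_disjoint_resonator_region[OF chain, of N]
    by (intro interior_maximal) (auto simp: less_imp_le)
  have cont_xp: "isCont u (xp j)" if "j \<le> N" for j
  proof (cases "j = 0")
    case True
    then show ?thesis
      using left_sub outer(1) by (intro solves_helmholtz_on_imp_isCont[OF solves(1)]) auto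
  qed (use that edges in auto)
  have cont_xm: "isCont u (xm (Suc j))" if "j \<le> N" for j
  proof (cases "j = N")
    case True
    then show ?thesis
      using right_sub outer(2) by (intro solves_helmholtz_on_imp_isCont[OF solves(1)]) auto
  qed (use that edges in auto)
  have lim_xp: "(?d \<longlongrightarrow> B j) (at_right (xp j))" if "j \<le> N" for j
  proof (cases "j = 0")
    case True
    have "((\<lambda>x. - \<i> * k * u x) \<longlongrightarrow> - \<i> * k * u (xp 0)) (at_right (xp 0))"
      using cont_xp[of 0] by (intro tendsto_intros) (auto simp: isCont_def intro: tendsto_within_subset)
    moreover have "eventually (\<lambda>x. ?d x = - \<i> * k * u x) (at_right (xp 0))"
      using eventually_at_right_real[OF outer(1)] by eventually_elim (use left in auto)
    ultimately show ?thesis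
      using True by (simp add: B_def filterlim_cong)
  qed (use that B0[of j] in \<open>auto simp: B_def\<close>)
  have lim_xm: "(?d \<longlongrightarrow> Q (Suc j)) (at_left (xm (Suc j)))" if "j \<le> N" for j
  proof (cases "j = N")
    case True
    have "((\<lambda>x. \<i> * k * u x) \<longlongrightarrow> \<i> * k * u (xm (Suc N))) (at_left (xm (Suc N)))"
      using cont_xm[of N] by (intro tendsto_intros) (auto simp: isCont_def intro: tendsto_within_subset)
    moreover have "eventually (\<lambda>x. ?d x = \<i> * k * u x) (at_left (xm (Suc N)))"
      using eventually_at_left_real[OF outer(2)] by eventually_elim (use right in auto)
    ultimately show ?thesis
      using True by (simp add: Q_def filterlim_cong)
  qed (use that Q0[of "Suc j"] in \<open>auto simp: Q_def\<close>)
  show thesis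
  proof
    show "helmholtz_between (\<omega> / of_real vb) (xm j) (\<delta> * Q j) (xp j) (\<delta> * B j) u"
      if j: "j \<in> {1..N}" for j
      using j edges[OF j] Q0[OF j] B0[OF j] chain
      by (intro helmholtz_betweenI[OF _ solves(2) inner_sub])
         (auto simp: Q_def B_def resonator_chain_def)
    show "helmholtz_between (\<omega> / of_real v) (xp j) (B j) (xm (Suc j)) (Q (Suc j)) u"
      if j: "j \<le> N" for j
    proof -
      have "xp j < xm (Suc j)"
      proof (cases "j = 0 \<or> j = N")
        case False
        then show ?thesis using j chain by (auto simp: resonator_chain_def)
      qed (use outer in auto)
      then show ?thesis
        using solves(1) unfolding k_def
        by (rule helmholtz_betweenI[OF _ _ gap_sub[OF j] cont_xp[OF j] cont_xm[OF j] lim_xp[OF j] lim_xm[OF j]])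
    qed
    show "B 0 = - \<i> * (\<omega> / of_real v) * u (xp 0)"
      by (simp add: B_def k_def)
    have "((\<lambda>x. \<i> * k * u x) \<longlongrightarrow> \<i> * k * u (xp N)) (at_right (xp N))"
      using cont_xp[of N] by (intro tendsto_intros) (auto simp: isCont_def intro: tendsto_within_subset)
    moreover have "eventually (\<lambda>x. ?d x = \<i> * k * u x) (at_right (xp N))"
      using eventually_at_right_less[of "xp N"] by eventually_elim (use right in auto)
    ultimately have "(?d \<longlongrightarrow> \<i> * k * u (xp N)) (at_right (xp N))"
      by (simp add: filterlim_cong)
    then show "B N = \<i> * (\<omega> / of_real v) * u (xp N)"
      using lim_xp[of N] unfolding k_def
      by (intro tendsto_unique[OF trivial_limit_at_right_real]) auto
  qed
qed

section \<open>The limiting recursion and the capacitance matrix\<close>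

text \<open>
  The recursion for the limiting pairs \<open>(a\<^sub>j, b\<^sub>j)\<close>, where \<open>a\<^sub>j\<close> is the value and \<open>b\<^sub>j\<close> the slope just to
  the right of resonator \<open>j\<close>.  The index \<open>0\<close> stands for the outer interval on the left.
\<close>

primrec limit_state :: "(nat \<Rightarrow> real) \<Rightarrow> (nat \<Rightarrow> real) \<Rightarrow> complex \<Rightarrow> nat \<Rightarrow> complex \<times> complex" where
  "limit_state s l \<mu> 0 = (1, 0)"
| "limit_state s l \<mu> (Suc j) =
     (let a = fst (limit_state s l \<mu> j) + snd (limit_state s l \<mu> j) * of_real (s j)
      in (a, snd (limit_state s l \<mu> j) - \<mu> * of_real (l (Suc j)) * a))"

text \<open>
  Summation by parts, as in the identity obtained by testing an equation \<open>- u'' = \<mu> \<rho> u\<close> with the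
  conjugate of \<open>u\<close>: the first sum is the elastic and the second the kinetic energy of the first
  \<open>n\<close> cells.
\<close>

lemma limit_energy:
  fixes a b :: "nat \<Rightarrow> complex" and s l :: "nat \<Rightarrow> real"
  assumes "b 0 = 0"
    and a_Suc: "\<And>j. a (Suc j) = a j + b j * of_real (s j)"
    and b_Suc: "\<And>j. b (Suc j) = b j - \<mu> * of_real (l (Suc j)) * a (Suc j)"
  shows "b n * cnj (a n) = of_real (\<Sum>j<n. s j * (norm (b j))\<^sup>2)
           - \<mu> * of_real (\<Sum>j<n. l (Suc j) * (norm (a (Suc j)))\<^sup>2)"
proof (induction n)
  case (Suc n)
  have "b (Suc n) * cnj (a (Suc n))
      = b n * cnj (a (Suc n)) - \<mu> * of_real (l (Suc n)) * (a (Suc n) * cnj (a (Suc n)))"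
    by (subst b_Suc) (simp add: algebra_simps)
  also have "b n * cnj (a (Suc n)) = b n * cnj (a n) + of_real (s n) * (b n * cnj (b n))"
    by (subst a_Suc) (simp add: algebra_simps)
  finally show ?case
    using Suc.IH by (simp add: algebra_simps flip: complex_norm_square)
qed (simp add: assms)

text \<open>
  Under the condition \<open>b N = 0\<close> the boundary term vanishes and \<open>\<mu>\<close> is the Rayleigh quotient of the
  two energies.
\<close>

lemma limit_parameter_nonneg_real:
  fixes a b :: "nat \<Rightarrow> complex" and s l :: "nat \<Rightarrow> real"
  assumes "b 0 = 0" and "a 0 \<noteq> 0"
    and a_Suc: "\<And>j. a (Suc j) = a j + b j * of_real (s j)"
    and b_Suc: "\<And>j. b (Suc j) = b j - \<mu> * of_real (l (Suc j)) * a (Suc j)"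
    and "b N = 0" "1 \<le> N" "\<And>j. j < N \<Longrightarrow> s j > 0" "\<And>j. j < N \<Longrightarrow> l (Suc j) > 0"
  obtains m :: real where "m \<ge> 0" "\<mu> = of_real m"
proof
  let ?S = "\<Sum>j<N. s j * (norm (b j))\<^sup>2"
  let ?T = "\<Sum>j<N. l (Suc j) * (norm (a (Suc j)))\<^sup>2"
  have "a 1 \<noteq> 0" using a_Suc[of 0] assms(1,2) by simp
  then have "l (Suc 0) * (norm (a (Suc 0)))\<^sup>2 > 0" using assms by simp
  then have T: "?T > 0"
    using assms(6,8) by (intro sum_pos2[of _ 0]) (auto intro!: mult_nonneg_nonneg simp: less_imp_le)
  have S: "?S \<ge> 0" using assms(7) by (intro sum_nonneg) (auto simp: less_imp_le)
  show "?S / ?T \<ge> 0" using S T by simp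
  have "\<mu> * of_real ?T = of_real ?S"
    using limit_energy[of b a s \<mu> l N, OF assms(1) a_Suc b_Suc] \<open>b N = 0\<close> by simp
  then show "\<mu> = of_real (?S / ?T)"
    using T by (simp add: field_simps del: of_real_sum)
qed

text \<open>
  Since \<open>theta\<close> has the factors \<open>1 / (r len)\<close> and \<open>1 / spacing\<close>, each row of the matrix computes the
  difference of the slopes on the two sides of a resonator, divided by \<open>r\<close> times its length.
  The conditions \<open>b 0 = 0\<close> and \<open>b N = 0\<close> account for the entries missing in the first and last row.
\<close>

lemma capacitance_matrix_eigenvector:
  fixes a b :: "nat \<Rightarrow> complex"
  assumes chain: "resonator_chain N xm xp" and "r > 0"
    and "b 0 = 0" and "a 0 \<noteq> 0" and "b N = 0"
    and a_Suc: "\<And>j. a (Suc j) = a j + b j * of_real (spacing xm xp j)"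
    and b_Suc: "\<And>j. b (Suc j) = b j - \<mu> * of_real (len xm xp (Suc j)) * a (Suc j)"
  shows "eigenvector (map_mat complex_of_real (capacitance_matrix N xm xp r))
           (vec N (\<lambda>i. a (Suc i))) (\<mu> / of_real r)"
proof -
  let ?C = "map_mat complex_of_real (capacitance_matrix N xm xp r)"
  let ?\<theta> = "\<lambda>m. complex_of_real (theta xm xp r m)"
  let ?x = "vec N (\<lambda>i. a (Suc i))"
  have N: "0 < N" using chain by (auto simp: resonator_chain_def)
  have dim: "dim_row ?C = N" "dim_col ?C = N" by (auto simp: capacitance_matrix_def)
  have len: "len xm xp (Suc i) > 0" if "i < N" for i
    using chain that by (auto simp: resonator_chain_def len_def)
  have spacing: "spacing xm xp i > 0" if "i \<in> {1..<N}" for i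
    using chain that by (auto simp: resonator_chain_def spacing_def)
  have "?x $ 0 \<noteq> 0"
    using N a_Suc[of 0] \<open>b 0 = 0\<close> \<open>a 0 \<noteq> 0\<close> by simp
  then have "?x \<noteq> 0\<^sub>v N" using N by (metis index_zero_vec(1))
  moreover have "?C *\<^sub>v ?x = (\<mu> / of_real r) \<cdot>\<^sub>v ?x"
  proof (rule eq_vecI)
    fix i assume "i < dim_vec ((\<mu> / of_real r) \<cdot>\<^sub>v ?x)"
    then have i: "i < N" by simp
    \<comment> \<open>The coupling to the left and to the right neighbour; in the corner rows one of them is
        absent.\<close>
    define lo hi where "lo = (if i = 0 then 0 else ?\<theta> (2 * i))"
      and "hi = (if Suc i = N then 0 else ?\<theta> (2 * i + 1))"
    have "(?C *\<^sub>v ?x) $ i = (\<Sum>j<N. ?C $$ (i, j) * a (Suc j))"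
      using i dim by (simp add: scalar_prod_def atLeast0LessThan)
    \<comment> \<open>For \<open>i = 0\<close> the index \<open>i - 1\<close> is \<open>i\<close> again, which is harmless because \<open>lo = 0\<close>.\<close>
    also have "\<dots> = (\<Sum>j<N. (if j = i then (lo + hi) * a (Suc j) else 0)
        + (if j = i - 1 then - lo * a (Suc j) else 0) + (if j = Suc i then - hi * a (Suc j) else 0))"
    proof (intro sum.cong refl)
      fix j assume "j \<in> {..<N}"
      then have entry: "?C $$ (i, j) = (if i = Suc j then - ?\<theta> (2 * i) else if j = i then lo + hi
          else if j = Suc i then - ?\<theta> (2 * i + 1) else 0)"
        using i by (simp add: capacitance_matrix_def lo_def hi_def)
      consider "i = Suc j" | "j = i" | "j = Suc i" | "i \<noteq> Suc j" "j \<noteq> i" "j \<noteq> Suc i" by blast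
      then show "?C $$ (i, j) * a (Suc j) = (if j = i then (lo + hi) * a (Suc j) else 0)
          + (if j = i - 1 then - lo * a (Suc j) else 0) + (if j = Suc i then - hi * a (Suc j) else 0)"
      proof cases
        case 3
        then have "j \<noteq> i - 1" "Suc i \<noteq> N" using \<open>j \<in> {..<N}\<close> by auto
        then show ?thesis using 3 unfolding entry by (simp add: hi_def)
      qed (unfold entry, auto simp: lo_def)
    qed
    also have "\<dots> = (lo + hi) * a (Suc i) - lo * a (Suc (i - 1)) - hi * a (Suc (Suc i))"
      using i by (auto simp: sum.distrib hi_def)
    also have "\<dots> = lo * (a (Suc i) - a (Suc (i - 1))) - hi * (a (Suc (Suc i)) - a (Suc i))"
      by (simp add: algebra_simps)
    also have "lo * (a (Suc i) - a (Suc (i - 1))) = b i / of_real (r * len xm xp (Suc i))"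
    proof (cases "i = 0")
      case False
      then show ?thesis
        using a_Suc[of i] spacing[of i] i \<open>r > 0\<close> len[of i]
        by (simp add: lo_def theta_def tseq_def field_simps)
    qed (simp add: lo_def \<open>b 0 = 0\<close>)
    also have "hi * (a (Suc (Suc i)) - a (Suc i)) = b (Suc i) / of_real (r * len xm xp (Suc i))"
    proof (cases "Suc i = N")
      case False
      then show ?thesis
        using a_Suc[of "Suc i"] spacing[of "Suc i"] i \<open>r > 0\<close> len[of i]
        by (simp add: hi_def theta_def tseq_def field_simps)
    qed (use \<open>b N = 0\<close> in \<open>simp add: hi_def\<close>)
    also have "b i = b (Suc i) + \<mu> * of_real (len xm xp (Suc i)) * a (Suc i)"
      using b_Suc[of i] by simp
    also have "\<dots> / of_real (r * len xm xp (Suc i)) - b (Suc i) / of_real (r * len xm xp (Suc i))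
        = \<mu> / of_real r * a (Suc i)"
      using len[OF i] \<open>r > 0\<close> by (simp add: field_simps)
    finally show "(?C *\<^sub>v ?x) $ i = ((\<mu> / of_real r) \<cdot>\<^sub>v ?x) $ i"
      using i by simp
  qed (use dim in simp)
  ultimately show ?thesis
    unfolding eigenvector_def dim by simp
qed

section \<open>Uniform asymptotics\<close>

text \<open>
  Uniform estimates are obtained throughout from a bound \<open>h\<close> depending on the parameter only.
\<close>

lemma unif_bigoI:
  assumes "\<forall>\<^sub>F \<delta> in at 0 within \<Delta>. \<forall>x\<in>S. norm (f \<delta> x) \<le> h \<delta>"
    and "h \<in> O[at 0 within \<Delta>](\<lambda>\<delta>. norm (g \<delta>))"
  shows "unif_bigo \<Delta> S f g"
proof -
  obtain c where "\<forall>\<^sub>F \<delta> in at 0 within \<Delta>. norm (h \<delta>) \<le> c * norm (norm (g \<delta>))"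
    using assms(2) by (elim landau_o.bigE)
  then have "\<forall>\<^sub>F \<delta> in at 0 within \<Delta>. \<forall>x\<in>S. norm (f \<delta> x) \<le> c * norm (g \<delta>)"
    using assms(1)
  proof eventually_elim
    case (elim \<delta>)
    then have "h \<delta> \<le> c * norm (g \<delta>)" by simp
    then show ?case using elim(2) by (auto intro: order_trans)
  qed
  moreover have "eventually (\<lambda>x. x \<in> S) (principal S)"
    by (simp add: eventually_principal)
  ultimately have "\<forall>\<^sub>F z in (at 0 within \<Delta>) \<times>\<^sub>F principal S.
      norm (case z of (\<delta>, x) \<Rightarrow> f \<delta> x) \<le> c * norm (case z of (\<delta>, x) \<Rightarrow> g \<delta>)"
    unfolding eventually_prod_filter by fastforce
  then show ?thesis
    unfolding unif_bigo_def by (rule bigoI)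
qed

lemma bigo_of_norm_le:
  assumes "\<forall>\<^sub>F d in F. norm (f d) \<le> h d" and "h \<in> O[F](\<lambda>d. norm (g d))"
  shows "f \<in> O[F](g)"
proof -
  have "\<forall>\<^sub>F d in F. norm (norm (f d)) \<le> 1 * norm (h d)"
    using assms(1) by eventually_elim auto
  then have "(\<lambda>d. norm (f d)) \<in> O[F](h)" by (rule bigoI)
  then show ?thesis
    using assms(2) landau_o.big_trans landau_o.big.norm_iff by blast
qed

lemma tendsto_zero_imp_bigo_one:
  assumes "(s \<longlongrightarrow> (0 :: 'b :: real_normed_field)) F"
  shows "s \<in> O[F](\<lambda>_. 1)"
proof (rule bigoI[of _ 1])
  have "eventually (\<lambda>d. norm (s d) < 1) F"
    using assms by (intro order_tendstoD(2)[where y = 0] tendsto_norm_zero) auto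
  then show "eventually (\<lambda>d. norm (s d) \<le> 1 * norm (1 :: 'b)) F"
    by eventually_elim simp
qed

lemma bigo_imp_tendsto_zero:
  assumes "f \<in> O[F](s)" "(s \<longlongrightarrow> 0) F"
  shows "(f \<longlongrightarrow> 0) F"
proof -
  obtain c where "\<forall>\<^sub>F d in F. norm (f d) \<le> c * norm (s d)"
    using assms(1) by (elim landau_o.bigE)
  moreover have "((\<lambda>d. c * norm (s d)) \<longlongrightarrow> 0) F"
    using assms(2) by (intro tendsto_mult_right_zero tendsto_norm_zero)
  ultimately show ?thesis by (rule Lim_null_comparison)
qed

lemma bigo_one_of_close:
  assumes "(\<lambda>d. f d - a) \<in> O[F](s)" "(s \<longlongrightarrow> 0) F"
  shows "f \<in> O[F](\<lambda>_. 1 :: 'b :: real_normed_field)"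
proof -
  have "(\<lambda>d. f d - a) \<in> O[F](\<lambda>_. 1)"
    using assms(1) tendsto_zero_imp_bigo_one[OF assms(2)] by (rule landau_o.big_trans)
  from sum_in_bigo(1)[OF this bigo_const[of a]] show ?thesis by simp
qed

text \<open>
  First order perturbation across a gap: if the value and the slope at the left end are
  \<open>a + O(s)\<close> and \<open>b + O(s)\<close>, the whole solution is the affine limit profile up to \<open>O(s)\<close>, and so
  is the slope handed over to the next edge.
\<close>

lemma arc_expansion:
  fixes F :: "'d filter" and s \<kappa> p q :: "'d \<Rightarrow> complex" and f :: "'d \<Rightarrow> real \<Rightarrow> complex"
  assumes "\<alpha> < \<beta>" and s: "(s \<longlongrightarrow> 0) F" and \<kappa>: "\<kappa> \<in> O[F](s)"
    and between: "\<forall>\<^sub>F d in F. helmholtz_between (\<kappa> d) \<alpha> (p d) \<beta> (q d) (f d)"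
    and a: "(\<lambda>d. f d \<alpha> - a) \<in> O[F](s)" and b: "(\<lambda>d. p d - b) \<in> O[F](s)"
  obtains h where "h \<in> O[F](\<lambda>d. norm (s d))"
    "\<forall>\<^sub>F d in F. \<forall>x\<in>{\<alpha>..\<beta>}. norm (f d x - (a + b * of_real (x - \<alpha>))) \<le> h d"
    "\<forall>\<^sub>F d in F. \<forall>x\<in>{\<alpha><..<\<beta>}. norm (vector_derivative (f d) (at x) - b) \<le> h d"
    "\<forall>\<^sub>F d in F. norm (q d - b) \<le> h d"
proof -
  define l where "l = \<beta> - \<alpha>"
  have l: "l > 0" using \<open>\<alpha> < \<beta>\<close> by (simp add: l_def)
  define E where "E d = 2 * (norm (f d \<alpha>) + norm (p d) * l)" for d
  define R where "R d = (norm (\<kappa> d))\<^sup>2 * (l + l\<^sup>2) * E d" for d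
  define h where "h d = norm (f d \<alpha> - a) + norm (p d - b) * (1 + l) + R d" for d
  have \<kappa>0: "(\<kappa> \<longlongrightarrow> 0) F" using \<kappa> s by (rule bigo_imp_tendsto_zero)
  have fO: "(\<lambda>d. norm (f d \<alpha>)) \<in> O[F](\<lambda>_. 1)"
    using bigo_one_of_close[OF a s] landau_o.big.norm_iff[of _ F "\<lambda>_. 1 :: complex"] by simp
  have pO: "(\<lambda>d. norm (p d)) \<in> O[F](\<lambda>_. 1)"
    using bigo_one_of_close[OF b s] landau_o.big.norm_iff[of _ F "\<lambda>_. 1 :: complex"] by simp
  have pl: "(\<lambda>d. norm (p d) * l) \<in> O[F](\<lambda>_. 1)"
    using landau_o.big.mult[OF pO bigo_const[of l]] by simp
  have EO: "E \<in> O[F](\<lambda>_. 1)"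
    using landau_o.big.mult[OF bigo_const[of 2] sum_in_bigo(1)[OF fO pl]] by (simp add: E_def[abs_def])
  have \<kappa>1: "(\<lambda>d. norm (\<kappa> d)) \<in> O[F](\<lambda>_. 1)"
    using tendsto_zero_imp_bigo_one[OF \<kappa>0] landau_o.big.norm_iff[of _ F "\<lambda>_. 1 :: complex"] by simp
  have \<kappa>s: "(\<lambda>d. norm (\<kappa> d)) \<in> O[F](\<lambda>d. norm (s d))" using \<kappa> by simp
  have RO: "R \<in> O[F](\<lambda>d. norm (s d))"
    using landau_o.big.mult[OF landau_o.big.mult[OF landau_o.big.mult[OF \<kappa>s \<kappa>1]
          bigo_const[of "l + l\<^sup>2"]] EO]
    by (simp add: R_def[abs_def] power2_eq_square)
  have "(\<lambda>d. norm (p d - b) * (1 + l)) \<in> O[F](\<lambda>d. norm (s d))"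
    using landau_o.big.mult[of "\<lambda>d. norm (p d - b)" F "\<lambda>d. norm (s d)", OF _ bigo_const[of "1 + l"]] b
    by simp
  then have hO: "h \<in> O[F](\<lambda>d. norm (s d))"
    unfolding h_def[abs_def] using RO a by (intro sum_in_bigo) simp_all
  have "((\<lambda>d. (norm (\<kappa> d))\<^sup>2 * l\<^sup>2) \<longlongrightarrow> (norm (0::complex))\<^sup>2 * l\<^sup>2) F"
    by (intro tendsto_intros \<kappa>0)
  then have "eventually (\<lambda>d. (norm (\<kappa> d))\<^sup>2 * l\<^sup>2 < 1 / 2) F"
    by (rule order_tendstoD) auto
  with between have good: "eventually (\<lambda>d. helmholtz_between (\<kappa> d) \<alpha> (p d) \<beta> (q d) (f d) \<and>
      (norm (\<kappa> d))\<^sup>2 * (\<beta> - \<alpha>)\<^sup>2 \<le> 1 / 2) F"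
    by eventually_elim (simp add: l_def)
  have R: "(norm (\<kappa> d))\<^sup>2 * l * E d \<le> R d" "(norm (\<kappa> d))\<^sup>2 * l\<^sup>2 * E d \<le> R d" for d
    using l by (simp_all add: R_def E_def algebra_simps)
  have ph: "R d + norm (p d - b) \<le> h d" for d
    using l by (simp add: h_def distrib_left)
  show thesis
  proof
    show "h \<in> O[F](\<lambda>d. norm (s d))" by (fact hO)
    show "\<forall>\<^sub>F d in F. \<forall>x\<in>{\<alpha>..\<beta>}. norm (f d x - (a + b * of_real (x - \<alpha>))) \<le> h d"
      using good
    proof (eventually_elim, intro ballI)
      fix d x assume d: "helmholtz_between (\<kappa> d) \<alpha> (p d) \<beta> (q d) (f d) \<and>
          (norm (\<kappa> d))\<^sup>2 * (\<beta> - \<alpha>)\<^sup>2 \<le> 1 / 2" and x: "x \<in> {\<alpha>..\<beta>}"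
      have "f d x - (a + b * of_real (x - \<alpha>)) = (f d x - f d \<alpha> - p d * of_real (x - \<alpha>))
          + (f d \<alpha> - a) + (p d - b) * of_real (x - \<alpha>)"
        by (simp add: algebra_simps)
      also have "norm \<dots> \<le> norm (f d x - f d \<alpha> - p d * of_real (x - \<alpha>)) + norm (f d \<alpha> - a)
          + norm ((p d - b) * of_real (x - \<alpha>))"
        by norm
      also have "norm ((p d - b) * of_real (x - \<alpha>)) \<le> norm (p d - b) * (1 + l)"
        using x by (auto simp: norm_mult l_def simp del: of_real_diff intro!: mult_left_mono)
      also have "norm (f d x - f d \<alpha> - p d * of_real (x - \<alpha>)) \<le> R d"
        using helmholtz_between_estimates(1)[OF \<open>\<alpha> < \<beta>\<close>, of "\<kappa> d" "p d" "q d" "f d" x] d x R(2)[of d]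
        by (simp add: E_def l_def)
      finally show "norm (f d x - (a + b * of_real (x - \<alpha>))) \<le> h d"
        by (simp add: h_def)
    qed
    show "\<forall>\<^sub>F d in F. \<forall>x\<in>{\<alpha><..<\<beta>}. norm (vector_derivative (f d) (at x) - b) \<le> h d"
      using good
    proof (eventually_elim, intro ballI)
      fix d x assume d: "helmholtz_between (\<kappa> d) \<alpha> (p d) \<beta> (q d) (f d) \<and>
          (norm (\<kappa> d))\<^sup>2 * (\<beta> - \<alpha>)\<^sup>2 \<le> 1 / 2" and x: "x \<in> {\<alpha><..<\<beta>}"
      have "norm (vector_derivative (f d) (at x) - b)
          \<le> norm (vector_derivative (f d) (at x) - p d) + norm (p d - b)"
        by norm
      moreover have "norm (vector_derivative (f d) (at x) - p d) \<le> R d"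
        using helmholtz_between_estimates(2)[OF \<open>\<alpha> < \<beta>\<close>, of "\<kappa> d" "p d" "q d" "f d" x] d x R(1)[of d]
        by (simp add: E_def l_def)
      ultimately show "norm (vector_derivative (f d) (at x) - b) \<le> h d"
        using ph[of d] by linarith
    qed
    show "\<forall>\<^sub>F d in F. norm (q d - b) \<le> h d"
      using good
    proof eventually_elim
      fix d assume d: "helmholtz_between (\<kappa> d) \<alpha> (p d) \<beta> (q d) (f d) \<and>
          (norm (\<kappa> d))\<^sup>2 * (\<beta> - \<alpha>)\<^sup>2 \<le> 1 / 2"
      have "norm (q d - b) \<le> norm (q d - p d) + norm (p d - b)"
        by norm
      moreover have "norm (q d - p d) \<le> R d"
        using helmholtz_between_estimates(3)[OF \<open>\<alpha> < \<beta>\<close>, of "\<kappa> d" "p d" "q d" "f d"] d R(1)[of d]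
        by (simp add: E_def l_def)
      ultimately show "norm (q d - b) \<le> h d"
        using ph[of d] by linarith
    qed
  qed
qed

text \<open>
  Perturbation across a resonator, with \<open>s\<^sup>2\<close> in the role of \<open>\<delta>\<close>.  The exterior slopes are the
  interior ones divided by \<open>s\<^sup>2\<close>, so the interior slope must be known up to \<open>o(s\<^sup>2)\<close>; the finer
  estimate for \<open>q - p\<close> determines it up to \<open>O(s\<^sup>4)\<close>.
\<close>

lemma resonator_expansion:
  fixes F :: "'d filter" and s \<kappa> Q B :: "'d \<Rightarrow> complex" and f :: "'d \<Rightarrow> real \<Rightarrow> complex"
  assumes "\<alpha> < \<beta>" and s: "(s \<longlongrightarrow> 0) F" and \<kappa>: "\<kappa> \<in> O[F](s)"
    and s_nz: "\<forall>\<^sub>F d in F. s d \<noteq> 0"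
    and \<mu>: "(\<lambda>d. (\<kappa> d)\<^sup>2 / (s d)\<^sup>2 - \<mu>) \<in> O[F](s)"
    and between: "\<forall>\<^sub>F d in F. helmholtz_between (\<kappa> d) \<alpha> ((s d)\<^sup>2 * Q d) \<beta> ((s d)\<^sup>2 * B d) (f d)"
    and a: "(\<lambda>d. f d \<alpha> - a) \<in> O[F](s)" and b: "(\<lambda>d. Q d - b) \<in> O[F](s)"
  obtains h g where "h \<in> O[F](\<lambda>d. norm (s d))" "g \<in> O[F](\<lambda>d. norm ((s d)\<^sup>2))"
    "\<forall>\<^sub>F d in F. \<forall>x\<in>{\<alpha>..\<beta>}. norm (f d x - a) \<le> h d"
    "\<forall>\<^sub>F d in F. \<forall>x\<in>{\<alpha><..<\<beta>}. norm (vector_derivative (f d) (at x)) \<le> g d"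
    "(\<lambda>d. B d - (b - \<mu> * of_real (\<beta> - \<alpha>) * a)) \<in> O[F](s)"
proof -
  define l where "l = \<beta> - \<alpha>"
  have l: "l > 0" using \<open>\<alpha> < \<beta>\<close> by (simp add: l_def)
  define p where "p d = (s d)\<^sup>2 * Q d" for d
  define E where "E d = 2 * (norm (f d \<alpha>) + norm (p d) * l)" for d
  define g where "g d = norm (p d) + (norm (\<kappa> d))\<^sup>2 * l * E d" for d
  define R where "R d = (norm (\<kappa> d))\<^sup>2 * l * (norm (p d) * l + (norm (\<kappa> d))\<^sup>2 * l\<^sup>2 * E d)" for d
  have s1: "s \<in> O[F](\<lambda>_. 1)" using s by (rule tendsto_zero_imp_bigo_one)
  have Q1: "Q \<in> O[F](\<lambda>_. 1)" using b s by (rule bigo_one_of_close)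
  have f1: "(\<lambda>d. f d \<alpha>) \<in> O[F](\<lambda>_. 1)" using a s by (rule bigo_one_of_close)
  have p2: "p \<in> O[F](\<lambda>d. (s d)\<^sup>2)"
    using landau_o.big.mult[OF landau_o.big_refl[of "\<lambda>d. (s d)\<^sup>2" F] Q1] by (simp add: p_def[abs_def])
  have s2: "(\<lambda>d. (s d)\<^sup>2) \<in> O[F](s)"
    using landau_o.big.mult[OF s1 landau_o.big_refl[of s F]] by (simp add: power2_eq_square)
  have ps: "p \<in> O[F](s)" using p2 s2 by (rule landau_o.big_trans)
  then have p0: "(\<lambda>d. p d - 0) \<in> O[F](s)" by simp
  \<comment> \<open>Seen at first order, the slope inside the resonator is zero.\<close>
  obtain h where h: "h \<in> O[F](\<lambda>d. norm (s d))"
      "\<forall>\<^sub>F d in F. \<forall>x\<in>{\<alpha>..\<beta>}. norm (f d x - (a + 0 * of_real (x - \<alpha>))) \<le> h d"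
    using arc_expansion[OF \<open>\<alpha> < \<beta>\<close> s \<kappa> between[folded p_def] a p0] by blast
  have pn: "(\<lambda>d. norm (p d)) \<in> O[F](\<lambda>d. norm ((s d)\<^sup>2))" using p2 by (simp only: landau_o.big.norm_iff)
  have \<kappa>n: "(\<lambda>d. (norm (\<kappa> d))\<^sup>2) \<in> O[F](\<lambda>d. norm ((s d)\<^sup>2))"
    using landau_o.big.mult[of "\<lambda>d. norm (\<kappa> d)" F "\<lambda>d. norm (s d)" "\<lambda>d. norm (\<kappa> d)" "\<lambda>d. norm (s d)"] \<kappa>
    by (simp add: power2_eq_square norm_mult)
  have p1: "(\<lambda>d. norm (p d)) \<in> O[F](\<lambda>_. 1)"
    using landau_o.big_trans[OF ps s1] landau_o.big.norm_iff[of p F "\<lambda>_. 1 :: complex"] by simp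
  have fn: "(\<lambda>d. norm (f d \<alpha>)) \<in> O[F](\<lambda>_. 1)"
    using f1 landau_o.big.norm_iff[of _ F "\<lambda>_. 1 :: complex"] by simp
  have pl: "(\<lambda>d. norm (p d) * l) \<in> O[F](\<lambda>_. 1)"
    using landau_o.big.mult[OF p1 bigo_const[of l]] by simp
  have EO: "E \<in> O[F](\<lambda>_. 1)"
    using landau_o.big.mult[OF bigo_const[of 2] sum_in_bigo(1)[OF fn pl]] by (simp add: E_def[abs_def])
  have \<kappa>lE: "(\<lambda>d. (norm (\<kappa> d))\<^sup>2 * l * E d) \<in> O[F](\<lambda>d. norm ((s d)\<^sup>2))" for l
    using landau_o.big.mult[OF landau_o.big.mult[OF \<kappa>n bigo_const[of l]] EO] by simp
  have gO: "g \<in> O[F](\<lambda>d. norm ((s d)\<^sup>2))"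
    unfolding g_def[abs_def] using pn \<kappa>lE by (rule sum_in_bigo)
  have "(\<lambda>d. norm (p d) * l) \<in> O[F](\<lambda>d. norm ((s d)\<^sup>2))"
    using landau_o.big.mult[OF pn bigo_const[of l]] by simp
  from landau_o.big.mult[OF landau_o.big.mult[OF \<kappa>n bigo_const[of l]] sum_in_bigo(1)[OF this \<kappa>lE[of "l\<^sup>2"]]]
  have RO: "R \<in> O[F](\<lambda>d. norm ((s d)\<^sup>2) * norm ((s d)\<^sup>2))"
    by (simp add: R_def[abs_def])
  have "((\<lambda>d. (norm (\<kappa> d))\<^sup>2 * l\<^sup>2) \<longlongrightarrow> (norm (0::complex))\<^sup>2 * l\<^sup>2) F"
    by (intro tendsto_intros bigo_imp_tendsto_zero[OF \<kappa> s])
  then have "eventually (\<lambda>d. (norm (\<kappa> d))\<^sup>2 * l\<^sup>2 < 1 / 2) F"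
    by (rule order_tendstoD) auto
  with between have good: "eventually (\<lambda>d. helmholtz_between (\<kappa> d) \<alpha> (p d) \<beta> ((s d)\<^sup>2 * B d) (f d) \<and>
      (norm (\<kappa> d))\<^sup>2 * (\<beta> - \<alpha>)\<^sup>2 \<le> 1 / 2) F"
    by eventually_elim (simp add: l_def p_def)
  have der: "\<forall>\<^sub>F d in F. \<forall>x\<in>{\<alpha><..<\<beta>}. norm (vector_derivative (f d) (at x)) \<le> g d"
    using good
  proof (eventually_elim, intro ballI)
    fix d x assume d: "helmholtz_between (\<kappa> d) \<alpha> (p d) \<beta> ((s d)\<^sup>2 * B d) (f d) \<and>
        (norm (\<kappa> d))\<^sup>2 * (\<beta> - \<alpha>)\<^sup>2 \<le> 1 / 2" and x: "x \<in> {\<alpha><..<\<beta>}"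
    have "norm (vector_derivative (f d) (at x)) \<le> norm (p d) + norm (vector_derivative (f d) (at x) - p d)"
      by norm
    also have "norm (vector_derivative (f d) (at x) - p d) \<le> (norm (\<kappa> d))\<^sup>2 * l * E d"
      using helmholtz_between_estimates(2)[OF \<open>\<alpha> < \<beta>\<close>, of "\<kappa> d" "p d" "(s d)\<^sup>2 * B d" "f d" x] d x
      by (simp add: E_def l_def)
    finally show "norm (vector_derivative (f d) (at x)) \<le> g d"
      by (simp add: g_def)
  qed
  \<comment> \<open>The defect in the transfer of the exterior slope, before \<open>\<kappa>\<^sup>2 / s\<^sup>2\<close> and \<open>f \<alpha>\<close> are replaced
      by their limits.\<close>
  define D where "D d = B d - Q d + (\<kappa> d)\<^sup>2 / (s d)\<^sup>2 * of_real l * f d \<alpha>" for d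
  have "\<forall>\<^sub>F d in F. norm (D d * (s d)\<^sup>2) \<le> R d"
    using good s_nz
  proof eventually_elim
    fix d assume d: "helmholtz_between (\<kappa> d) \<alpha> (p d) \<beta> ((s d)\<^sup>2 * B d) (f d) \<and>
        (norm (\<kappa> d))\<^sup>2 * (\<beta> - \<alpha>)\<^sup>2 \<le> 1 / 2" and "s d \<noteq> 0"
    then have "D d * (s d)\<^sup>2 = (s d)\<^sup>2 * B d - p d + (\<kappa> d)\<^sup>2 * of_real l * f d \<alpha>"
      by (simp add: D_def p_def field_simps)
    then show "norm (D d * (s d)\<^sup>2) \<le> R d"
      using helmholtz_between_estimates(4)[OF \<open>\<alpha> < \<beta>\<close>, of "\<kappa> d" "p d" "(s d)\<^sup>2 * B d" "f d"] d
      by (simp add: E_def l_def R_def)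
  qed
  moreover have "R \<in> O[F](\<lambda>d. norm ((s d)\<^sup>2 * (s d)\<^sup>2))"
    using RO by (simp only: norm_mult)
  ultimately have "(\<lambda>d. D d * (s d)\<^sup>2) \<in> O[F](\<lambda>d. (s d)\<^sup>2 * (s d)\<^sup>2)"
    by (rule bigo_of_norm_le)
  then have quot: "(\<lambda>d. D d * (s d)\<^sup>2 / (s d)\<^sup>2) \<in> O[F](\<lambda>d. (s d)\<^sup>2 * (s d)\<^sup>2 / (s d)\<^sup>2)"
    using s_nz by (intro landau_o.big.divide_right) (auto elim: eventually_mono)
  have "\<forall>\<^sub>F d in F. D d * (s d)\<^sup>2 / (s d)\<^sup>2 = D d"
      "\<forall>\<^sub>F d in F. (s d)\<^sup>2 * (s d)\<^sup>2 / (s d)\<^sup>2 = (s d)\<^sup>2"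
    using s_nz by (auto elim!: eventually_mono simp: power2_eq_square power4_eq_xxxx)
  from landau_o.big.cong_ex[OF this, THEN iffD1, OF quot] have "D \<in> O[F](\<lambda>d. (s d)\<^sup>2)" .
  then have DO: "D \<in> O[F](s)" using s2 by (rule landau_o.big_trans)
  have T1: "(\<lambda>d. ((\<kappa> d)\<^sup>2 / (s d)\<^sup>2 - \<mu>) * (of_real l * f d \<alpha>)) \<in> O[F](s)"
    using landau_o.big.mult[OF \<mu> landau_o.big.mult[OF bigo_const[of "of_real l"] f1]] by simp
  have T2: "(\<lambda>d. \<mu> * of_real l * (f d \<alpha> - a)) \<in> O[F](s)"
    using landau_o.big.mult[OF bigo_const[of "\<mu> * of_real l"] a] by simp
  have "(\<lambda>d. D d + (Q d - b) - (((\<kappa> d)\<^sup>2 / (s d)\<^sup>2 - \<mu>) * (of_real l * f d \<alpha>)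
      + \<mu> * of_real l * (f d \<alpha> - a))) \<in> O[F](s)"
    by (rule sum_in_bigo(2)[OF sum_in_bigo(1)[OF DO b] sum_in_bigo(1)[OF T1 T2]])
  moreover have "(\<lambda>d. D d + (Q d - b) - (((\<kappa> d)\<^sup>2 / (s d)\<^sup>2 - \<mu>) * (of_real l * f d \<alpha>)
      + \<mu> * of_real l * (f d \<alpha> - a))) = (\<lambda>d. B d - (b - \<mu> * of_real (\<beta> - \<alpha>) * a))"
    by (rule ext) (simp add: D_def l_def algebra_simps)
  ultimately have BO: "(\<lambda>d. B d - (b - \<mu> * of_real (\<beta> - \<alpha>) * a)) \<in> O[F](s)"
    by (rule back_subst)
  show thesis
  proof (rule that[OF h(1) gO _ der BO])
    show "\<forall>\<^sub>F d in F. \<forall>x\<in>{\<alpha>..\<beta>}. norm (f d x - a) \<le> h d" using h(2) by simp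
  qed
qed

section \<open>Expansion of the frequency\<close>

text \<open>
  Taylor's formula to second order.  The quotient \<open>W z / z\<close> extends to a holomorphic function \<open>g\<close>,
  and differentiability of \<open>g\<close> at \<open>0\<close> bounds \<open>(W z - g 0 z) / z = g z - g 0\<close> by a multiple of \<open>z\<close>.
\<close>

lemma analytic_at_zero_expansion:
  assumes "W analytic_on {0}" "W 0 = 0"
  obtains c where "(\<lambda>z. W z - c * z) \<in> O[nhds 0](\<lambda>z. z\<^sup>2)"
proof -
  obtain S where S: "open S" "0 \<in> S" "W holomorphic_on S"
    using assms(1) by (auto simp: analytic_at)
  define g where "g z = (if z = 0 then deriv W 0 else (W z - W 0) / (z - 0))" for z
  have "g holomorphic_on S"
    unfolding g_def[abs_def] using S by (intro pole_lemma) (auto simp: interior_open)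
  then have "g field_differentiable (at 0)"
    using S by (simp add: holomorphic_on_open field_differentiable_def)
  then obtain g' where "(g has_field_derivative g') (at 0)"
    by (auto simp: field_differentiable_def)
  then have "((\<lambda>z. (g z - g 0) / z) \<longlongrightarrow> g') (at 0)"
    by (simp add: has_field_derivative_iff)
  then have "((\<lambda>z. norm ((g z - g 0) / z)) \<longlongrightarrow> norm g') (at 0)"
    by (rule tendsto_norm)
  then have "eventually (\<lambda>z. norm ((g z - g 0) / z) < norm g' + 1) (at 0)"
    by (rule order_tendstoD) simp
  then have "eventually (\<lambda>z. z \<noteq> 0 \<longrightarrow> norm ((g z - g 0) / z) < norm g' + 1) (nhds 0)"
    by (simp add: eventually_at_filter)
  then have "eventually (\<lambda>z. norm (W z - g 0 * z) \<le> (norm g' + 1) * norm (z\<^sup>2)) (nhds 0)"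
  proof eventually_elim
    case (elim z)
    show ?case
    proof (cases "z = 0")
      case False
      then have "W z - g 0 * z = (g z - g 0) / z * z\<^sup>2"
        using \<open>W 0 = 0\<close> by (simp add: g_def field_simps power2_eq_square)
      then have "norm (W z - g 0 * z) = norm ((g z - g 0) / z) * norm (z\<^sup>2)"
        by (simp only: norm_mult)
      then show ?thesis
        using elim False by (simp add: mult_right_mono)
    qed (simp add: \<open>W 0 = 0\<close>)
  qed
  then have "(\<lambda>z. W z - g 0 * z) \<in> O[nhds 0](\<lambda>z. z\<^sup>2)"
    by (rule bigoI)
  then show thesis by (rule that)
qed

lemma exp_minus_one_bigo: "(\<lambda>z :: complex. exp z - 1) \<in> O[nhds 0](\<lambda>z. z)"
proof -
  have "(\<lambda>z :: complex. exp z - 1) analytic_on {0}"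
    by (intro analytic_intros)
  moreover have "exp (0 :: complex) - 1 = 0" by simp
  ultimately obtain c where c: "(\<lambda>z. exp z - 1 - c * z) \<in> O[nhds 0](\<lambda>z :: complex. z\<^sup>2)"
    by (rule analytic_at_zero_expansion)
  have "((\<lambda>z :: complex. z) \<longlongrightarrow> 0) (nhds 0)" by (simp add: filterlim_ident)
  from tendsto_zero_imp_bigo_one[OF this]
  have "(\<lambda>z :: complex. z\<^sup>2) \<in> O[nhds 0](\<lambda>z. z)"
    using landau_o.big.mult[OF landau_o.big_refl[of "\<lambda>z :: complex. z" "nhds 0"]]
    by (fastforce simp: power2_eq_square)
  with c have "(\<lambda>z. exp z - 1 - c * z) \<in> O[nhds 0](\<lambda>z :: complex. z)"
    by (rule landau_o.big_trans)
  from sum_in_bigo(1)[OF this, of "\<lambda>z. c * z"] show ?thesis by simp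
qed

text \<open>
  The limit point assumption is what forces \<open>W 0 = 0\<close>: the limits along \<open>\<Delta>\<close> are unique.
\<close>

lemma analytic_in_root_expansion:
  assumes "0 islimpt \<Delta>" and \<sigma>: "(\<sigma> \<longlongrightarrow> 0) (at 0 within \<Delta>)"
    and \<omega>: "(\<omega> \<longlongrightarrow> 0) (at 0 within \<Delta>)" and "analytic_in_root \<Delta> \<sigma> \<omega>"
  obtains c where "(\<lambda>\<delta>. \<omega> \<delta> - c * \<sigma> \<delta>) \<in> O[at 0 within \<Delta>](\<lambda>\<delta>. (\<sigma> \<delta>)\<^sup>2)"
proof -
  let ?F = "at 0 within \<Delta>"
  obtain W where W: "W analytic_on {0}" and ev: "\<forall>\<^sub>F \<delta> in ?F. \<omega> \<delta> = W (\<sigma> \<delta>)"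
    using assms(4) by (auto simp: analytic_in_root_def)
  have "isCont W 0"
    using W by (simp add: analytic_at_imp_isCont)
  then have "((\<lambda>\<delta>. W (\<sigma> \<delta>)) \<longlongrightarrow> W 0) ?F"
    using \<sigma> by (rule isCont_tendsto_compose)
  moreover have "((\<lambda>\<delta>. W (\<sigma> \<delta>)) \<longlongrightarrow> 0) ?F"
    using Lim_transform_eventually[OF \<omega> ev] .
  moreover have "?F \<noteq> bot"
    using \<open>0 islimpt \<Delta>\<close> by (simp add: trivial_limit_within)
  ultimately have "W 0 = 0" by (metis tendsto_unique)
  with W obtain c where "(\<lambda>z. W z - c * z) \<in> O[nhds 0](\<lambda>z. z\<^sup>2)"
    by (rule analytic_at_zero_expansion)
  from landau_o.big.compose[OF this \<sigma>]
  have "(\<lambda>\<delta>. W (\<sigma> \<delta>) - c * \<sigma> \<delta>) \<in> O[?F](\<lambda>\<delta>. (\<sigma> \<delta>)\<^sup>2)" .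
  moreover have "\<forall>\<^sub>F \<delta> in ?F. W (\<sigma> \<delta>) - c * \<sigma> \<delta> = \<omega> \<delta> - c * \<sigma> \<delta>"
    using ev by eventually_elim simp
  ultimately show thesis
    by (intro that) (rule iffD1[OF landau_o.big.in_cong, rotated])
qed

text \<open>
  The error is \<open>O(s)\<close> because \<open>\<omega>\<^sup>2 - c\<^sup>2 s\<^sup>2\<close> factors into \<open>\<omega> - c s = O(s\<^sup>2)\<close> and \<open>\<omega> + c s = O(s)\<close>.
\<close>

lemma square_ratio_expansion:
  fixes \<omega> s :: "'d \<Rightarrow> complex"
  assumes s_nz: "\<forall>\<^sub>F d in F. s d \<noteq> 0" and \<omega>: "\<omega> \<in> O[F](s)"
    and c: "(\<lambda>d. \<omega> d - c * s d) \<in> O[F](\<lambda>d. (s d)\<^sup>2)"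
  shows "(\<lambda>d. (\<omega> d / w)\<^sup>2 / (s d)\<^sup>2 - (c / w)\<^sup>2) \<in> O[F](s)"
proof -
  have quot: "(\<lambda>d. (\<omega> d - c * s d) / (s d)\<^sup>2) \<in> O[F](\<lambda>d. (s d)\<^sup>2 / (s d)\<^sup>2)"
    using s_nz c by (intro landau_o.big.divide_right) (auto elim: eventually_mono)
  have one: "\<forall>\<^sub>F d in F. (s d)\<^sup>2 / (s d)\<^sup>2 = 1"
    using s_nz by eventually_elim simp
  have q: "(\<lambda>d. (\<omega> d - c * s d) / (s d)\<^sup>2) \<in> O[F](\<lambda>_. 1)"
    using quot unfolding landau_o.big.cong[OF one] .
  have cs: "(\<lambda>d. c * s d) \<in> O[F](s)" by simp
  have "(\<lambda>d. (\<omega> d - c * s d) / (s d)\<^sup>2 * ((\<omega> d + c * s d) * inverse (w\<^sup>2))) \<in> O[F](s)"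
    using landau_o.big.mult[OF q landau_o.big.mult[OF sum_in_bigo(1)[OF \<omega> cs] bigo_const[of "inverse (w\<^sup>2)"]]]
    by simp
  moreover have "\<forall>\<^sub>F d in F. (\<omega> d - c * s d) / (s d)\<^sup>2 * ((\<omega> d + c * s d) * inverse (w\<^sup>2))
      = (\<omega> d / w)\<^sup>2 / (s d)\<^sup>2 - (c / w)\<^sup>2"
    using s_nz
  proof eventually_elim
    case (elim d)
    then show ?case
      by (cases "w = 0") (auto simp: power2_eq_square field_simps)
  qed
  ultimately show ?thesis
    by (rule iffD1[OF landau_o.big.in_cong, rotated])
qed

section \<open>Asymptotics of subwavelength resonant modes\<close>

theorem theorem4p6:
  fixes N :: nat and xm xp :: "nat \<Rightarrow> real" and v vb M :: real
    and \<Delta> :: "complex set" and \<sigma> \<omega> :: "complex \<Rightarrow> complex"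
    and u :: "complex \<Rightarrow> real \<Rightarrow> complex"
  assumes "resonator_chain N xm xp" and "v > 0" and "vb > 0"
    and "xp 0 = - M" and "xm (Suc N) = M" and "- M < xm 1" and "xp N < M"
    and "0 islimpt \<Delta>" and "\<And>\<delta>. \<delta> \<in> \<Delta> \<Longrightarrow> (\<sigma> \<delta>)\<^sup>2 = \<delta>"
    and "subwavelength_resonance N xm xp v vb \<Delta> \<omega>"
    and "\<omega> \<in> O[at 0 within \<Delta>](\<sigma>)"
    and "analytic_in_root \<Delta> \<sigma> \<omega>"
    and "\<forall>\<^sub>F \<delta> in at 0 within \<Delta>.
           nontrivial_scattering_solution N xm xp v vb \<delta> (\<omega> \<delta>) (u \<delta>) \<and>
           (\<forall>x<xm 1. u \<delta> x = exp (- \<i> * (\<omega> \<delta> / of_real v) * of_real x))"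
  shows "\<exists>(ev :: real) (a :: nat \<Rightarrow> complex) (b :: nat \<Rightarrow> complex).
     corresponds_to_eigenvalue v (v / vb) \<Delta> \<sigma> \<omega> ev \<and>
     eigenvector (map_mat complex_of_real (capacitance_matrix N xm xp (v / vb)))
       (vec N (\<lambda>i. a (Suc i))) (complex_of_real ev) \<and>
     (\<forall>j\<in>{1..<N}. b j = (a (Suc j) - a j) / of_real (spacing xm xp j)) \<and>
     (\<forall>j\<in>{1..N}. unif_bigo \<Delta> {xm j<..<xp j} (\<lambda>\<delta> x. u \<delta> x - a j) \<sigma>) \<and>
     (\<forall>j\<in>{0..N}. unif_bigo \<Delta> {xp j<..<xm (Suc j)}
        (\<lambda>\<delta> x. u \<delta> x - (a j + b j * of_real (x - xp j))) \<sigma>) \<and>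
     (\<forall>j\<in>{1..N}. unif_bigo \<Delta> {xm j<..<xp j}
        (\<lambda>\<delta> x. vector_derivative (u \<delta>) (at x)) (\<lambda>\<delta>. \<delta>)) \<and>
     (\<forall>j\<in>{0..N}. unif_bigo \<Delta> {xp j<..<xm (Suc j)}
        (\<lambda>\<delta> x. vector_derivative (u \<delta>) (at x) - b j) \<sigma>)"
proof -
  let ?F = "at 0 within \<Delta>"
  note chain = assms(1) and root = assms(9) and sol = assms(13)
  have outer: "xp 0 < xm 1" "xp N < xm (Suc N)" using assms(4-7) by auto
  have N: "1 \<le> N" using chain by (simp add: resonator_chain_def)
  have inner_lt: "xm j < xp j" if "j \<in> {1..N}" for j
    using chain that by (simp add: resonator_chain_def)
  have gap_lt: "xp j < xm (Suc j)" if "j \<le> N" for j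
  proof (cases "j = 0 \<or> j = N")
    case False
    then show ?thesis using that chain by (auto simp: resonator_chain_def)
  qed (use outer in auto)
  have nontriv: "?F \<noteq> bot" using assms(8) by (simp add: trivial_limit_within)
  have root_ev: "\<forall>\<^sub>F \<delta> in ?F. (\<sigma> \<delta>)\<^sup>2 = \<delta> \<and> \<delta> \<noteq> 0"
    using root by (auto simp: eventually_at_filter)
  then have \<sigma>_nz: "\<forall>\<^sub>F \<delta> in ?F. \<sigma> \<delta> \<noteq> 0"
    by (auto elim!: eventually_mono)
  \<comment> \<open>Any choice of square roots tends to zero, since its modulus is \<open>sqrt \<bar>\<delta>\<bar>\<close>.\<close>
  have \<sigma>0: "(\<sigma> \<longlongrightarrow> 0) ?F"
  proof (rule tendsto_norm_zero_cancel, rule Lim_transform_eventually)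
    have "((\<lambda>\<delta>. sqrt (norm \<delta>)) \<longlongrightarrow> sqrt (norm (0 :: complex))) ?F"
      by (intro tendsto_intros)
    then show "((\<lambda>\<delta>. sqrt (norm \<delta>)) \<longlongrightarrow> 0) ?F" by simp
    show "\<forall>\<^sub>F \<delta> in ?F. sqrt (norm \<delta>) = norm (\<sigma> \<delta>)"
      using root_ev by eventually_elim (metis norm_ge_zero norm_power real_sqrt_unique)
  qed
  have \<omega>0: "(\<omega> \<longlongrightarrow> 0) ?F" using assms(11) \<sigma>0 by (rule bigo_imp_tendsto_zero)
  obtain c where c: "(\<lambda>\<delta>. \<omega> \<delta> - c * \<sigma> \<delta>) \<in> O[?F](\<lambda>\<delta>. (\<sigma> \<delta>)\<^sup>2)"
    using analytic_in_root_expansion[OF assms(8) \<sigma>0 \<omega>0 assms(12)] .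
  define \<mu> where "\<mu> = (c / of_real vb)\<^sup>2"
  have k_bigo: "(\<lambda>\<delta>. \<omega> \<delta> / of_real w) \<in> O[?F](\<sigma>)" for w
    using landau_o.big.mult[OF assms(11) bigo_const[of "inverse (of_real w)"]]
    by (simp add: divide_inverse)
  have \<mu>: "(\<lambda>\<delta>. (\<omega> \<delta> / of_real vb)\<^sup>2 / (\<sigma> \<delta>)\<^sup>2 - \<mu>) \<in> O[?F](\<sigma>)"
    unfolding \<mu>_def using \<sigma>_nz assms(11) c by (rule square_ratio_expansion)

  \<comment> \<open>The exterior slopes of \<open>u \<delta>\<close>, chosen for every small \<open>\<delta>\<close>, with \<open>\<delta>\<close> written as \<open>(\<sigma> \<delta>)\<^sup>2\<close>.\<close>
  define arcs where "arcs \<delta> Q B \<longleftrightarrow>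
      (\<forall>j\<in>{1..N}. helmholtz_between (\<omega> \<delta> / of_real vb) (xm j) ((\<sigma> \<delta>)\<^sup>2 * Q j) (xp j) ((\<sigma> \<delta>)\<^sup>2 * B j) (u \<delta>)) \<and>
      (\<forall>j\<le>N. helmholtz_between (\<omega> \<delta> / of_real v) (xp j) (B j) (xm (Suc j)) (Q (Suc j)) (u \<delta>)) \<and>
      B 0 = - \<i> * (\<omega> \<delta> / of_real v) * u \<delta> (xp 0) \<and>
      B N = \<i> * (\<omega> \<delta> / of_real v) * u \<delta> (xp N)" for \<delta> and Q B :: "nat \<Rightarrow> complex"
  have "\<forall>\<^sub>F \<delta> in ?F. \<exists>QB. arcs \<delta> (fst QB) (snd QB)"
    using sol root_ev
  proof eventually_elim
    case (elim \<delta>)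
    then have "scattering_solution N xm xp v vb ((\<sigma> \<delta>)\<^sup>2) (\<omega> \<delta>) (u \<delta>)"
      by (simp add: nontrivial_scattering_solution_def)
    then obtain Q B where "arcs \<delta> Q B"
      using scattering_solution_arcs[OF chain _ outer] unfolding arcs_def by metis
    then show ?case by (intro exI[of _ "(Q, B)"]) simp
  qed
  then obtain QB where "\<forall>\<^sub>F \<delta> in ?F. arcs \<delta> (fst (QB \<delta>)) (snd (QB \<delta>))"
    unfolding eventually_ex by blast
  then obtain Q B where arcs: "\<forall>\<^sub>F \<delta> in ?F. arcs \<delta> (Q \<delta>) (B \<delta>)" by (rule that)
  have inner_arc: "\<forall>\<^sub>F \<delta> in ?F. helmholtz_between (\<omega> \<delta> / of_real vb) (xm j)
      ((\<sigma> \<delta>)\<^sup>2 * Q \<delta> j) (xp j) ((\<sigma> \<delta>)\<^sup>2 * B \<delta> j) (u \<delta>)" if "j \<in> {1..N}" for j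
    using arcs by eventually_elim (use that in \<open>auto simp: arcs_def\<close>)
  have gap_arc: "\<forall>\<^sub>F \<delta> in ?F. helmholtz_between (\<omega> \<delta> / of_real v) (xp j)
      (B \<delta> j) (xm (Suc j)) (Q \<delta> (Suc j)) (u \<delta>)" if "j \<le> N" for j
    using arcs by eventually_elim (use that in \<open>auto simp: arcs_def\<close>)

  \<comment> \<open>The candidate limits are defined for every \<open>\<mu>\<close>; that \<open>\<mu>\<close> is admissible will follow from the
      radiation condition at the right end.\<close>
  define a where "a j = fst (limit_state (spacing xm xp) (len xm xp) \<mu> j)" for j
  define b where "b j = snd (limit_state (spacing xm xp) (len xm xp) \<mu> j)" for j
  have ab0: "a 0 = 1" "b 0 = 0" by (simp_all add: a_def b_def)
  have a_Suc: "a (Suc j) = a j + b j * of_real (spacing xm xp j)" for j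
    by (simp add: a_def b_def Let_def)
  have b_Suc: "b (Suc j) = b j - \<mu> * of_real (len xm xp (Suc j)) * a (Suc j)" for j
    by (simp add: a_def b_def Let_def)

  have gap_step: "\<exists>h. h \<in> O[?F](\<lambda>\<delta>. norm (\<sigma> \<delta>)) \<and>
      (\<forall>\<^sub>F \<delta> in ?F. \<forall>x\<in>{xp j..xm (Suc j)}. norm (u \<delta> x - (a j + b j * of_real (x - xp j))) \<le> h \<delta>) \<and>
      (\<forall>\<^sub>F \<delta> in ?F. \<forall>x\<in>{xp j<..<xm (Suc j)}. norm (vector_derivative (u \<delta>) (at x) - b j) \<le> h \<delta>) \<and>
      (\<forall>\<^sub>F \<delta> in ?F. norm (Q \<delta> (Suc j) - b j) \<le> h \<delta>)"
    if "j \<le> N" "(\<lambda>\<delta>. u \<delta> (xp j) - a j) \<in> O[?F](\<sigma>)" "(\<lambda>\<delta>. B \<delta> j - b j) \<in> O[?F](\<sigma>)" for j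
    by (rule arc_expansion[OF gap_lt[OF that(1)] \<sigma>0 k_bigo gap_arc[OF that(1)] that(2,3)])
       (intro exI conjI)
  have gap_end: "(\<lambda>\<delta>. u \<delta> (xm (Suc j)) - a (Suc j)) \<in> O[?F](\<sigma>)" "(\<lambda>\<delta>. Q \<delta> (Suc j) - b j) \<in> O[?F](\<sigma>)"
    if j: "j \<le> N" "(\<lambda>\<delta>. u \<delta> (xp j) - a j) \<in> O[?F](\<sigma>)" "(\<lambda>\<delta>. B \<delta> j - b j) \<in> O[?F](\<sigma>)" for j
  proof -
    obtain h where h: "h \<in> O[?F](\<lambda>\<delta>. norm (\<sigma> \<delta>))"
      "\<forall>\<^sub>F \<delta> in ?F. \<forall>x\<in>{xp j..xm (Suc j)}. norm (u \<delta> x - (a j + b j * of_real (x - xp j))) \<le> h \<delta>"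
      "\<forall>\<^sub>F \<delta> in ?F. norm (Q \<delta> (Suc j) - b j) \<le> h \<delta>"
      using gap_step[OF j] by blast
    have "\<forall>\<^sub>F \<delta> in ?F. norm (u \<delta> (xm (Suc j)) - a (Suc j)) \<le> h \<delta>"
      using h(2) by eventually_elim (use gap_lt[OF j(1)] in \<open>auto simp: a_Suc spacing_def\<close>)
    then show "(\<lambda>\<delta>. u \<delta> (xm (Suc j)) - a (Suc j)) \<in> O[?F](\<sigma>)"
      using h(1) by (rule bigo_of_norm_le)
    show "(\<lambda>\<delta>. Q \<delta> (Suc j) - b j) \<in> O[?F](\<sigma>)"
      using h(3,1) by (rule bigo_of_norm_le)
  qed
  have inner_step: "\<exists>h g. h \<in> O[?F](\<lambda>\<delta>. norm (\<sigma> \<delta>)) \<and> g \<in> O[?F](\<lambda>\<delta>. norm ((\<sigma> \<delta>)\<^sup>2)) \<and>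
      (\<forall>\<^sub>F \<delta> in ?F. \<forall>x\<in>{xm (Suc j)..xp (Suc j)}. norm (u \<delta> x - a (Suc j)) \<le> h \<delta>) \<and>
      (\<forall>\<^sub>F \<delta> in ?F. \<forall>x\<in>{xm (Suc j)<..<xp (Suc j)}. norm (vector_derivative (u \<delta>) (at x)) \<le> g \<delta>) \<and>
      (\<lambda>\<delta>. B \<delta> (Suc j) - b (Suc j)) \<in> O[?F](\<sigma>)"
    if j: "j < N" "(\<lambda>\<delta>. u \<delta> (xp j) - a j) \<in> O[?F](\<sigma>)" "(\<lambda>\<delta>. B \<delta> j - b j) \<in> O[?F](\<sigma>)" for j
  proof -
    have j': "Suc j \<in> {1..N}" "j \<le> N" using j(1) by auto
    show ?thesis
      unfolding b_Suc len_def
      by (rule resonator_expansion[OF inner_lt[OF j'(1)] \<sigma>0 k_bigo \<sigma>_nz \<mu> inner_arc[OF j'(1)]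
            gap_end[OF j'(2) j(2,3)]])
         (intro exI conjI)
  qed
  \<comment> \<open>Induction along the chain: one gap followed by one resonator.\<close>
  have near: "(\<lambda>\<delta>. u \<delta> (xp j) - a j) \<in> O[?F](\<sigma>) \<and> (\<lambda>\<delta>. B \<delta> j - b j) \<in> O[?F](\<sigma>)" if "j \<le> N" for j
    using that
  proof (induction j)
    case 0
    have z: "(\<lambda>\<delta>. - \<i> * (\<omega> \<delta> / of_real v) * of_real (xp 0)) \<in> O[?F](\<sigma>)"
      using landau_o.big.mult[OF bigo_const[of "- \<i> * of_real (xp 0)"] k_bigo[of v]]
      by (simp add: mult_ac)
    have "(\<lambda>\<delta>. exp (- \<i> * (\<omega> \<delta> / of_real v) * of_real (xp 0)) - 1) \<in> O[?F](\<sigma>)"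
      using landau_o.big.compose[OF exp_minus_one_bigo bigo_imp_tendsto_zero[OF z \<sigma>0]] z
      by (rule landau_o.big_trans)
    moreover have "\<forall>\<^sub>F \<delta> in ?F. exp (- \<i> * (\<omega> \<delta> / of_real v) * of_real (xp 0)) - 1 = u \<delta> (xp 0) - a 0"
      using sol by eventually_elim (use outer in \<open>simp add: ab0\<close>)
    ultimately have u0: "(\<lambda>\<delta>. u \<delta> (xp 0) - a 0) \<in> O[?F](\<sigma>)"
      by (rule iffD1[OF landau_o.big.in_cong, rotated])
    have "(\<lambda>\<delta>. - \<i> * (\<omega> \<delta> / of_real v) * u \<delta> (xp 0)) \<in> O[?F](\<sigma>)"
      using landau_o.big.mult[OF landau_o.big.mult[OF bigo_const[of "- \<i>"] k_bigo[of v]]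
          bigo_one_of_close[OF u0 \<sigma>0]] by simp
    moreover have "\<forall>\<^sub>F \<delta> in ?F. - \<i> * (\<omega> \<delta> / of_real v) * u \<delta> (xp 0) = B \<delta> 0 - b 0"
      using arcs by eventually_elim (simp add: arcs_def ab0)
    ultimately have "(\<lambda>\<delta>. B \<delta> 0 - b 0) \<in> O[?F](\<sigma>)"
      by (rule iffD1[OF landau_o.big.in_cong, rotated])
    with u0 show ?case ..
  next
    case (Suc j)
    then have j: "j < N" "(\<lambda>\<delta>. u \<delta> (xp j) - a j) \<in> O[?F](\<sigma>)" "(\<lambda>\<delta>. B \<delta> j - b j) \<in> O[?F](\<sigma>)"
      by auto
    obtain h where h: "h \<in> O[?F](\<lambda>\<delta>. norm (\<sigma> \<delta>))"
      "\<forall>\<^sub>F \<delta> in ?F. \<forall>x\<in>{xm (Suc j)..xp (Suc j)}. norm (u \<delta> x - a (Suc j)) \<le> h \<delta>"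
      "(\<lambda>\<delta>. B \<delta> (Suc j) - b (Suc j)) \<in> O[?F](\<sigma>)"
      using inner_step[OF j] by blast
    have "\<forall>\<^sub>F \<delta> in ?F. norm (u \<delta> (xp (Suc j)) - a (Suc j)) \<le> h \<delta>"
      using h(2) by eventually_elim (use inner_lt[of "Suc j"] j(1) in auto)
    then have "(\<lambda>\<delta>. u \<delta> (xp (Suc j)) - a (Suc j)) \<in> O[?F](\<sigma>)"
      using h(1) by (rule bigo_of_norm_le)
    then show ?case using h(3) by simp
  qed

  \<comment> \<open>The slope to the right of the last resonator is \<open>i k u = O(\<sigma>)\<close>, so its limit vanishes.\<close>
  have "b N = 0"
  proof -
    have uN: "(\<lambda>\<delta>. u \<delta> (xp N) - a N) \<in> O[?F](\<sigma>)" and BN: "(\<lambda>\<delta>. B \<delta> N - b N) \<in> O[?F](\<sigma>)"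
      using near[of N] by auto
    have "(\<lambda>\<delta>. \<i> * (\<omega> \<delta> / of_real v) * u \<delta> (xp N)) \<in> O[?F](\<sigma>)"
      using landau_o.big.mult[OF landau_o.big.mult[OF bigo_const[of "\<i>"] k_bigo[of v]]
          bigo_one_of_close[OF uN \<sigma>0]] by simp
    then have "((\<lambda>\<delta>. \<i> * (\<omega> \<delta> / of_real v) * u \<delta> (xp N)) \<longlongrightarrow> 0) ?F"
      using \<sigma>0 by (rule bigo_imp_tendsto_zero)
    moreover have "\<forall>\<^sub>F \<delta> in ?F. \<i> * (\<omega> \<delta> / of_real v) * u \<delta> (xp N) = B \<delta> N"
      using arcs by eventually_elim (simp add: arcs_def)
    ultimately have "((\<lambda>\<delta>. B \<delta> N) \<longlongrightarrow> 0) ?F"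
      by (rule Lim_transform_eventually)
    moreover have "((\<lambda>\<delta>. B \<delta> N) \<longlongrightarrow> b N) ?F"
      using bigo_imp_tendsto_zero[OF BN \<sigma>0] by (simp add: LIM_zero_iff)
    ultimately show ?thesis using nontriv tendsto_unique by blast
  qed

  obtain m where m: "m \<ge> 0" "\<mu> = of_real m"
  proof (rule limit_parameter_nonneg_real[of b a "spacing xm xp" \<mu> "len xm xp" N])
    show "spacing xm xp j > 0" if "j < N" for j
      using gap_lt[of j] that by (simp add: spacing_def)
    show "len xm xp (Suc j) > 0" if "j < N" for j
      using inner_lt[of "Suc j"] that by (simp add: len_def)
  qed (use ab0 a_Suc b_Suc \<open>b N = 0\<close> N in auto)
  \<comment> \<open>From here on the limit data are identified with the spectral data of the matrix.\<close>
  define r where "r = v / vb"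
  have r: "r > 0" using assms(2,3) by (simp add: r_def)
  have eigen: "eigenvector (map_mat complex_of_real (capacitance_matrix N xm xp r))
      (vec N (\<lambda>i. a (Suc i))) (complex_of_real (m / r))"
    using capacitance_matrix_eigenvector[OF chain r, of b a \<mu>] ab0 \<open>b N = 0\<close> a_Suc b_Suc m(2)
    by simp
  have sq: "\<forall>\<^sub>F \<delta> in ?F. (\<sigma> \<delta>)\<^sup>2 = \<delta>"
    using root_ev by eventually_elim simp
  have corr: "corresponds_to_eigenvalue v r \<Delta> \<sigma> \<omega> (m / r)"
  proof -
    have "c\<^sup>2 = of_real (m * vb\<^sup>2)"
      using m(2) assms(3) by (simp add: \<mu>_def field_simps)
    also have "m * vb\<^sup>2 = (v * sqrt (m / r / r))\<^sup>2"
      using m(1) assms(2,3) by (simp add: power_mult_distrib r_def power2_eq_square field_simps)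
    finally have "c\<^sup>2 = (of_real (v * sqrt (m / r / r)))\<^sup>2"
      by (simp only: of_real_power)
    then have "c = 1 * of_real (v * sqrt (m / r / r)) \<or> c = - 1 * of_real (v * sqrt (m / r / r))"
      unfolding power2_eq_iff by simp
    then obtain \<epsilon> :: complex where "\<epsilon> \<in> {1, -1}" "c = \<epsilon> * of_real (v * sqrt (m / r / r))"
      by blast
    moreover have "(\<lambda>\<delta>. \<omega> \<delta> - c * \<sigma> \<delta>) \<in> O[?F](\<lambda>\<delta>. \<delta>)"
      using c unfolding landau_o.big.cong[OF sq] .
    ultimately show ?thesis unfolding corresponds_to_eigenvalue_def by blast
  qed

  have inner: "unif_bigo \<Delta> {xm j<..<xp j} (\<lambda>\<delta> x. u \<delta> x - a j) \<sigma> \<and>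
      unif_bigo \<Delta> {xm j<..<xp j} (\<lambda>\<delta> x. vector_derivative (u \<delta>) (at x)) (\<lambda>\<delta>. \<delta>)"
    if j: "j \<in> {1..N}" for j
  proof -
    obtain i where i: "j = Suc i" "i < N" using j by (cases j) auto
    obtain h g where hg: "h \<in> O[?F](\<lambda>\<delta>. norm (\<sigma> \<delta>))" "g \<in> O[?F](\<lambda>\<delta>. norm ((\<sigma> \<delta>)\<^sup>2))"
      "\<forall>\<^sub>F \<delta> in ?F. \<forall>x\<in>{xm j..xp j}. norm (u \<delta> x - a j) \<le> h \<delta>"
      "\<forall>\<^sub>F \<delta> in ?F. \<forall>x\<in>{xm j<..<xp j}. norm (vector_derivative (u \<delta>) (at x)) \<le> g \<delta>"
      using inner_step[OF i(2)] near[of i] i by auto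
    have norm_sq: "\<forall>\<^sub>F \<delta> in ?F. norm ((\<sigma> \<delta>)\<^sup>2) = norm \<delta>"
      using sq by eventually_elim simp
    have "g \<in> O[?F](\<lambda>\<delta>. norm \<delta>)"
      using hg(2) unfolding landau_o.big.cong[OF norm_sq] .
    with hg(4) have "unif_bigo \<Delta> {xm j<..<xp j} (\<lambda>\<delta> x. vector_derivative (u \<delta>) (at x)) (\<lambda>\<delta>. \<delta>)"
      by (rule unif_bigoI)
    moreover have "\<forall>\<^sub>F \<delta> in ?F. \<forall>x\<in>{xm j<..<xp j}. norm (u \<delta> x - a j) \<le> h \<delta>"
      using hg(3) by eventually_elim auto
    ultimately show ?thesis by (intro conjI unif_bigoI[OF _ hg(1)])
  qed
  have gap: "unif_bigo \<Delta> {xp j<..<xm (Suc j)} (\<lambda>\<delta> x. u \<delta> x - (a j + b j * of_real (x - xp j))) \<sigma> \<and>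
      unif_bigo \<Delta> {xp j<..<xm (Suc j)} (\<lambda>\<delta> x. vector_derivative (u \<delta>) (at x) - b j) \<sigma>"
    if "j \<in> {0..N}" for j
  proof -
    have j: "j \<le> N" using that by simp
    obtain h where h: "h \<in> O[?F](\<lambda>\<delta>. norm (\<sigma> \<delta>))"
      "\<forall>\<^sub>F \<delta> in ?F. \<forall>x\<in>{xp j..xm (Suc j)}. norm (u \<delta> x - (a j + b j * of_real (x - xp j))) \<le> h \<delta>"
      "\<forall>\<^sub>F \<delta> in ?F. \<forall>x\<in>{xp j<..<xm (Suc j)}. norm (vector_derivative (u \<delta>) (at x) - b j) \<le> h \<delta>"
      using gap_step[OF j] near[OF j] by blast
    have "\<forall>\<^sub>F \<delta> in ?F. \<forall>x\<in>{xp j<..<xm (Suc j)}.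
        norm (u \<delta> x - (a j + b j * of_real (x - xp j))) \<le> h \<delta>"
      using h(2) by eventually_elim auto
    then show ?thesis using h(3) by (intro conjI unif_bigoI[OF _ h(1)])
  qed
  have slope: "b j = (a (Suc j) - a j) / of_real (spacing xm xp j)" if "j \<in> {1..<N}" for j
    using gap_lt[of j] that by (simp add: a_Suc spacing_def)
  show ?thesis
    unfolding r_def[symmetric]
    by (intro exI[of _ "m / r"] exI[of _ a] exI[of _ b] conjI ballI corr eigen)
       (use inner gap slope in auto)
qed

end
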